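(* For any $\alpha>0$ there exists a strictly convex analytic function $F(t)$ on $(\alpha,\infty)$, with its supporting lines intersecting the vertical axis in some interval $[\underline\gamma,\overline\gamma]\subset[0,\infty)$, such that there does not exist any Hölder potential $\phi$ on any shift space of finite type satisfying $$P(t\phi)=F(t)$$ on $(\alpha,\infty)$.
   Context: Shift spaces of finite type are symbolic spaces over a finite alphabet $\Lambda$, with shift map $\sigma$ and metric $d(x,y)=2^{-l(x,y)}$ where $l(x,y)$ is the first index at which $x$ and $y$ differ. A potential $\phi$ is Hölder if it is real-valued and Hölder continuous for some exponent $0<h\le1$ with respect to this metric. The pressure of a continuous potential is $P(\phi)=\sup\{h(\mu)+\int\phi\,d\mu:\mu\text{ a }\sigma\text{-invariant probability measure}\}$. A supporting line of $F$ at $t_0$ is a line through $(t_0,F(t_0))$ lying below the graph of $F$; the vertical axis is $\{t=0\}$. *)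

theory Defs
  imports "HOL-Probability.Probability"
begin

section \<open>Shift spaces of finite type\<close>

text \<open>
  A symbol sequence over the index set \<open>I\<close> is an extensional function on \<open>I\<close>;
  \<open>I = {0..}\<close> gives one-sided shifts and \<open>I = UNIV\<close> gives two-sided ones.
  A finite alphabet is, up to renaming symbols, a finite set of natural numbers; having the
  alphabet as a set rather than a type allows quantification over all alphabets inside a formula.
\<close>

definition shift :: "int set \<Rightarrow> (int \<Rightarrow> nat) \<Rightarrow> int \<Rightarrow> nat" where
  "shift I x = (\<lambda>i\<in>I. x (i + 1))"

definition occurs_in :: "int set \<Rightarrow> nat list \<Rightarrow> (int \<Rightarrow> nat) \<Rightarrow> bool" where
  "occurs_in I w x \<longleftrightarrow> (\<exists>i\<in>I. \<forall>k<length w. x (i + int k) = w ! k)"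

definition shift_of_finite_type :: "int set \<Rightarrow> nat set \<Rightarrow> (int \<Rightarrow> nat) set \<Rightarrow> bool" where
  "shift_of_finite_type I \<Lambda> X \<longleftrightarrow>
     finite \<Lambda> \<and>
     (\<exists>W. finite W \<and> W \<subseteq> lists \<Lambda> \<and> X = {x \<in> I \<rightarrow>\<^sub>E \<Lambda>. \<forall>w\<in>W. \<not> occurs_in I w x})"

text \<open>On two-sided sequences the first index of difference is taken in absolute value.\<close>

definition first_diff :: "int set \<Rightarrow> (int \<Rightarrow> nat) \<Rightarrow> (int \<Rightarrow> nat) \<Rightarrow> nat" where
  "first_diff I x y = (LEAST n. \<exists>i\<in>I. nat \<bar>i\<bar> = n \<and> x i \<noteq> y i)"

definition sdist :: "int set \<Rightarrow> (int \<Rightarrow> nat) \<Rightarrow> (int \<Rightarrow> nat) \<Rightarrow> real" where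
  "sdist I x y = (if x = y then 0 else 2 powr - real (first_diff I x y))"

definition hoelder_potential ::
    "int set \<Rightarrow> (int \<Rightarrow> nat) set \<Rightarrow> ((int \<Rightarrow> nat) \<Rightarrow> real) \<Rightarrow> bool" where
  "hoelder_potential I X \<phi> \<longleftrightarrow>
     (\<exists>h C. 0 < h \<and> h \<le> 1 \<and> (\<forall>x\<in>X. \<forall>y\<in>X. \<bar>\<phi> x - \<phi> y\<bar> \<le> C * sdist I x y powr h))"


section \<open>Entropy and pressure\<close>

definition partition_entropy :: "'a measure \<Rightarrow> 'a set set \<Rightarrow> real" where
  "partition_entropy M P = - (\<Sum>A\<in>P. measure M A * ln (measure M A))"

text \<open>The join of the preimages of \<open>P\<close> under \<open>T ^^ i\<close> for \<open>i < n\<close>.  It may contain the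
  empty set, which contributes nothing to the entropy because \<open>0 * ln 0 = 0\<close>.\<close>

definition refined_partition :: "'a measure \<Rightarrow> ('a \<Rightarrow> 'a) \<Rightarrow> 'a set set \<Rightarrow> nat \<Rightarrow> 'a set set" where
  "refined_partition M T P n =
     (\<lambda>A. {x \<in> space M. \<forall>i<n. (T ^^ i) x \<in> A i}) ` ({..<n} \<rightarrow>\<^sub>E P)"

text \<open>For invariant \<open>M\<close> the limit exists by subadditivity, so \<open>liminf\<close> is the limit.\<close>

definition entropy_of_partition :: "'a measure \<Rightarrow> ('a \<Rightarrow> 'a) \<Rightarrow> 'a set set \<Rightarrow> ereal" where
  "entropy_of_partition M T P =
     liminf (\<lambda>n. ereal (partition_entropy M (refined_partition M T P n) / real n))"

definition ks_entropy :: "'a measure \<Rightarrow> ('a \<Rightarrow> 'a) \<Rightarrow> ereal" where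
  "ks_entropy M T =
     (SUP P \<in> {P. finite P \<and> P \<subseteq> sets M \<and> partition_on (space M) P}. entropy_of_partition M T P)"

text \<open>The sigma-algebra on \<open>X\<close> is generated by the cylinder sets; as the alphabet is finite,
  it is the Borel sigma-algebra of \<open>sdist\<close>.\<close>

definition shift_space :: "int set \<Rightarrow> nat set \<Rightarrow> (int \<Rightarrow> nat) set \<Rightarrow> (int \<Rightarrow> nat) measure" where
  "shift_space I \<Lambda> X = restrict_space (\<Pi>\<^sub>M i\<in>I. count_space \<Lambda>) X"

definition invariant_measures ::
    "int set \<Rightarrow> nat set \<Rightarrow> (int \<Rightarrow> nat) set \<Rightarrow> (int \<Rightarrow> nat) measure set" where
  "invariant_measures I \<Lambda> X =
     {\<mu>. prob_space \<mu> \<and> sets \<mu> = sets (shift_space I \<Lambda> X) \<and>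
         shift I \<in> measurable \<mu> \<mu> \<and> distr \<mu> \<mu> (shift I) = \<mu>}"

definition pressure ::
    "int set \<Rightarrow> nat set \<Rightarrow> (int \<Rightarrow> nat) set \<Rightarrow> ((int \<Rightarrow> nat) \<Rightarrow> real) \<Rightarrow> ereal" where
  "pressure I \<Lambda> X \<phi> =
     (SUP \<mu> \<in> invariant_measures I \<Lambda> X. ks_entropy \<mu> (shift I) + ereal (\<integral>x. \<phi> x \<partial>\<mu>))"


section \<open>Real functions\<close>

definition strictly_convex_on :: "real set \<Rightarrow> (real \<Rightarrow> real) \<Rightarrow> bool" where
  "strictly_convex_on S F \<longleftrightarrow>
     convex S \<and>
     (\<forall>x\<in>S. \<forall>y\<in>S. \<forall>u. x \<noteq> y \<and> 0 < u \<and> u < 1 \<longrightarrow>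
        F ((1 - u) * x + u * y) < (1 - u) * F x + u * F y)"

definition real_analytic_on :: "real set \<Rightarrow> (real \<Rightarrow> real) \<Rightarrow> bool" where
  "real_analytic_on S F \<longleftrightarrow> (\<forall>t\<in>S. \<exists>G. (\<lambda>s. F (t + s)) has_fps_expansion G)"

text \<open>The line through \<open>(t\<^sub>0, F t\<^sub>0)\<close> of slope \<open>m\<close> lies below the graph of \<open>F\<close> on \<open>S\<close>.
  It meets the vertical axis at height \<open>F t\<^sub>0 - m * t\<^sub>0\<close>.\<close>

definition supporting_line :: "real set \<Rightarrow> (real \<Rightarrow> real) \<Rightarrow> real \<Rightarrow> real \<Rightarrow> bool" where
  "supporting_line S F t\<^sub>0 m \<longleftrightarrow> t\<^sub>0 \<in> S \<and> (\<forall>t\<in>S. F t\<^sub>0 + m * (t - t\<^sub>0) \<le> F t)"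

end

theory Submission
  imports Defs
begin

text \<open>
  Let \<open>\<phi>\<close> be a Hoelder potential on a shift of finite type \<open>X\<close>.  The pressure \<open>P t\<close> of
  \<open>t * \<phi>\<close> cannot approach \<open>0\<close> superexponentially fast as \<open>t\<close> grows while staying positive.
  The function \<open>F t = exp (- (t + 1)\<^sup>2)\<close> does exactly that.  It is entire, strictly convex for
  positive \<open>t\<close>, and its supporting lines meet the vertical axis between \<open>0\<close> and \<open>3\<close>.

  Suppose that \<open>P = F\<close> on a half-line.  Entropy is nonnegative and \<open>F\<close> is bounded, so every
  invariant measure has \<open>\<integral>\<phi> \<le> 0\<close>.  Membership in \<open>X\<close> depends only on windows of some fixed
  length \<open>M\<close>; call the window of \<open>x\<close> at time \<open>n\<close> its state, and call a state rich if there are two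
  different loops of the same length at it, that is, if its component carries positive entropy.
  A point is returning at time \<open>m\<close> if its initial state is rich and can be reached again from its
  state at time \<open>m\<close>.  There are two cases.

  \<^item> For every \<open>m\<close> some point that is returning at time \<open>m\<close> has Birkhoff sum at least \<open>- 1\<close> up to
    time \<open>m\<close>.  Follow it for \<open>m = r * l\<close> steps, insert one detour of length \<open>l\<close> at one of the \<open>r\<close>
    times divisible by \<open>l\<close>, and close up.  This gives \<open>r\<close> different loops of a common length
    \<open>L \<le> K * r\<close>, and by bounded distortion each costs at most a constant \<open>D\<close> (\<open>many_loops\<close>).
    Concatenating them at random gives an invariant measure, whence \<open>P t \<ge> (ln r - t * D) / L\<close>
    (\<open>pressure_ge_of_loops\<close>).  With \<open>r\<close> about \<open>exp (D * t + 1)\<close> this is at least a constant times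
    \<open>exp (- D * t)\<close>, which exceeds \<open>F t\<close> for large \<open>t\<close>.

  \<^item> For some \<open>m\<close> all points that are returning at time \<open>m\<close> have Birkhoff sum at most \<open>- 1\<close>.  By
    Poincare recurrence almost every point is either returning at all times or periodic with a
    fixed period.  The periodic part of a measure contributes no entropy and a nonpositive integral.
    On the other part \<open>\<integral>\<phi> \<le> - 1 / m\<close>, while the entropy is bounded because \<open>P\<close> is finite at one
    parameter.  So \<open>P t \<le> 0\<close> for large \<open>t\<close> (\<open>pressure_nonpos_of_negative_returns\<close>), but \<open>F t > 0\<close>.
\<close>

section \<open>A strictly convex function that decays faster than every exponential\<close>

lemma strictly_convex_onI_deriv:
  fixes f f' :: "real \<Rightarrow> real"
  assumes S: "convex S"
    and deriv: "\<And>t. t \<in> S \<Longrightarrow> (f has_real_derivative f' t) (at t)"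
    and mono: "\<And>s t. s \<in> S \<Longrightarrow> t \<in> S \<Longrightarrow> s < t \<Longrightarrow> f' s < f' t"
  shows "strictly_convex_on S f"
proof -
  have chord: "f ((1 - u) * x + u * y) < (1 - u) * f x + u * f y"
    if xy: "x \<in> S" "y \<in> S" "x < y" "0 < u" "u < 1" for x y u :: real
  proof -
    define z where "z = (1 - u) * x + u * y"
    have zx: "z - x = u * (y - x)" and yz: "y - z = (1 - u) * (y - x)"
      by (simp_all add: z_def algebra_simps)
    have "x < z" "z < y"
      using xy zx yz by (metis diff_gt_0_iff_gt mult_pos_pos)+
    have inS: "w \<in> S" if "x \<le> w" "w \<le> y" for w
      using S xy that unfolding is_interval_convex_1[symmetric] is_interval_1 by blast
    obtain a where a: "x < a" "a < z" "f z - f x = (z - x) * f' a"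
      using MVT2[OF \<open>x < z\<close>, of f f'] deriv inS \<open>z < y\<close> by (metis less_eq_real_def order_trans)
    obtain b where b: "z < b" "b < y" "f y - f z = (y - z) * f' b"
      using MVT2[OF \<open>z < y\<close>, of f f'] deriv inS \<open>x < z\<close> by (metis less_eq_real_def order_trans)
    have "f' a < f' b" using a b by (intro mono inS) auto
    hence "u * (1 - u) * (y - x) * f' a < u * (1 - u) * (y - x) * f' b"
      using xy by (intro mult_strict_left_mono) auto
    hence "(1 - u) * (f z - f x) < u * (f y - f z)"
      unfolding a b zx yz by (simp add: mult_ac)
    thus ?thesis unfolding z_def[symmetric] by (simp add: algebra_simps)
  qed
  show ?thesis
    unfolding strictly_convex_on_def
  proof (intro conjI ballI allI impI)
    fix x y u :: real assume "x \<in> S" "y \<in> S" "x \<noteq> y \<and> 0 < u \<and> u < 1"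
    thus "f ((1 - u) * x + u * y) < (1 - u) * f x + u * f y"
      using chord[of x y u] chord[of y x "1 - u"] by (cases "x < y") (auto simp: add.commute)
  qed (rule S)
qed

definition gauss :: "real \<Rightarrow> real" where
  "gauss t = exp (- (t + 1)\<^sup>2)"

lemma gauss_pos: "0 < gauss t"
  by (simp add: gauss_def)

lemma gauss_le_1: "gauss t \<le> 1"
  by (simp add: gauss_def)

lemma DERIV_gauss: "(gauss has_real_derivative - 2 * (t + 1) * gauss t) (at t)"
  unfolding gauss_def[abs_def]
  by (auto intro!: derivative_eq_intros)

lemma strictly_convex_gauss:
  assumes "0 \<le> \<alpha>"
  shows "strictly_convex_on {\<alpha><..} gauss"
proof (rule strictly_convex_onI_deriv)
  fix s t :: real assume st: "s \<in> {\<alpha><..}" "t \<in> {\<alpha><..}" "s < t"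
  show "- 2 * (s + 1) * gauss s < - 2 * (t + 1) * gauss t"
  proof (rule DERIV_pos_imp_increasing[OF st(3)])
    fix x assume "s \<le> x" "x \<le> t"
    hence "1 < (x + 1)\<^sup>2" using st assms by (simp add: one_less_power)
    hence "0 < (4 * (x + 1)\<^sup>2 - 2) * gauss x" by (intro mult_pos_pos gauss_pos) simp
    moreover have "((\<lambda>x. - 2 * (x + 1) * gauss x) has_real_derivative (4 * (x + 1)\<^sup>2 - 2) * gauss x) (at x)"
      by (rule derivative_eq_intros DERIV_gauss | simp)+ (simp add: algebra_simps power2_eq_square)
    ultimately show "\<exists>y. ((\<lambda>x. - 2 * (x + 1) * gauss x) has_real_derivative y) (at x) \<and> 0 < y"
      by blast
  qed
qed (use DERIV_gauss in \<open>auto simp: convex_real_interval\<close>)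

text \<open>
  The exponential series in \<open>- s\<^sup>2\<close>, reindexed over the even exponents.
\<close>

lemma has_fps_expansion_exp_minus_square:
  "(\<lambda>s::real. exp (- s\<^sup>2)) has_fps_expansion
     Abs_fps (\<lambda>n. if even n then (- 1) ^ (n div 2) / fact (n div 2) else 0)"
  (is "_ has_fps_expansion Abs_fps ?c")
proof -
  have sums: "(\<lambda>n. ?c n * s ^ n) sums exp (- s\<^sup>2)" for s :: real
  proof -
    have "(\<lambda>k. (- s\<^sup>2) ^ k /\<^sub>R fact k) sums exp (- s\<^sup>2)"
      by (rule exp_converges)
    also have "(- s\<^sup>2) ^ k = (- 1) ^ k * s ^ (2 * k)" for k
      by (subst power_minus) (simp only: power_mult)
    hence "(\<lambda>k. (- s\<^sup>2) ^ k /\<^sub>R fact k) = (\<lambda>k. ?c (2 * k) * s ^ (2 * k))"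
      by (simp add: divide_inverse mult_ac)
    finally show ?thesis
      by (subst (asm) sums_mono_reindex) (auto simp: strict_mono_def elim!: evenE)
  qed
  have "conv_radius ?c = \<infinity>"
    using sums by (intro conv_radius_inftyI'') (auto dest: sums_summable)
  thus ?thesis
    using sums by (auto simp: has_fps_expansion_def fps_conv_radius_def eval_fps_def sums_iff)
qed

lemma real_analytic_gauss: "real_analytic_on S gauss"
  unfolding real_analytic_on_def
proof
  fix t :: real
  have "gauss (t + s) = gauss t * (exp ((- 2 * (t + 1)) * s) * exp (- s\<^sup>2))" for s
    by (simp add: gauss_def algebra_simps power2_eq_square flip: exp_add)
  thus "\<exists>G. (\<lambda>s. gauss (t + s)) has_fps_expansion G"
    using has_fps_expansion_mult[OF has_fps_expansion_const has_fps_expansion_mult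
        [OF has_fps_expansion_exp has_fps_expansion_exp_minus_square]]
    by auto
qed

text \<open>
  A supporting line at an interior point is the tangent, so its intercept is
  \<open>gauss t + 2 * t * (t + 1) * gauss t\<close>, and \<open>x \<le> exp x\<close> at \<open>x = (t + 1)\<^sup>2\<close> bounds the second term.
\<close>

lemma gauss_intercept:
  assumes "0 \<le> \<alpha>" "supporting_line {\<alpha><..} gauss t m"
  shows "gauss t - m * t \<in> {0..3}"
proof -
  have t: "\<alpha> < t" and line: "\<And>s. \<alpha> < s \<Longrightarrow> gauss t + m * (s - t) \<le> gauss s"
    using assms(2) by (auto simp: supporting_line_def)
  have "((\<lambda>s. gauss s - m * (s - t)) has_real_derivative - 2 * (t + 1) * gauss t - m) (at t)"
    by (auto intro!: derivative_eq_intros DERIV_gauss)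
  moreover have "\<forall>s. \<bar>t - s\<bar> < t - \<alpha> \<longrightarrow> gauss t - m * (t - t) \<le> gauss s - m * (s - t)"
  proof (intro allI impI)
    fix s assume "\<bar>t - s\<bar> < t - \<alpha>"
    hence "\<alpha> < s" by arith
    thus "gauss t - m * (t - t) \<le> gauss s - m * (s - t)" using line[of s] by simp
  qed
  ultimately have "- 2 * (t + 1) * gauss t - m = 0"
    using t by (intro DERIV_local_min[where d = "t - \<alpha>"]) auto
  hence m: "m = - 2 * (t + 1) * gauss t" by simp
  have "0 < t" using t assms by simp
  have "t * (t + 1) * gauss t \<le> (t + 1)\<^sup>2 * gauss t"
    using \<open>0 < t\<close> gauss_pos[of t] by (intro mult_right_mono) (auto simp: power2_eq_square)
  also have "\<dots> \<le> exp ((t + 1)\<^sup>2) * gauss t"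
    using gauss_pos[of t] exp_ge_add_one_self[of "(t + 1)\<^sup>2"]
    by (intro mult_right_mono) linarith+
  also have "\<dots> = 1" by (simp add: gauss_def flip: exp_add)
  finally have "t * (t + 1) * gauss t \<le> 1" .
  moreover have "0 \<le> t * (t + 1) * gauss t" using \<open>0 < t\<close> gauss_pos[of t] by simp
  moreover have "gauss t - m * t = gauss t + 2 * (t * (t + 1) * gauss t)"
    by (simp add: m algebra_simps)
  ultimately show ?thesis
    using gauss_le_1[of t] gauss_pos[of t] by simp
qed

lemma exponential_not_below_gauss:
  assumes "\<And>t. \<alpha> < t \<Longrightarrow> c * exp (- (C * t)) \<le> gauss t"
  shows "c \<le> 0"
proof (rule ccontr)
  assume "\<not> c \<le> 0"
  hence c: "0 < c" by simp
  \<comment> \<open>Taking logarithms, \<open>(t + 1)\<^sup>2 \<le> C * t - ln c\<close> fails from here on.\<close>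
  define t where "t = max (\<bar>\<alpha>\<bar> + 1) (\<bar>C\<bar> + \<bar>ln c\<bar>)"
  have t: "1 \<le> t" "\<alpha> < t" "\<bar>C\<bar> + \<bar>ln c\<bar> \<le> t" by (auto simp: t_def)
  have "exp (ln c - C * t) = c * exp (- (C * t))" using c by (simp add: exp_diff exp_minus field_simps)
  also have "\<dots> \<le> exp (- (t + 1)\<^sup>2)" using assms[OF t(2)] by (simp add: gauss_def)
  finally have "(t + 1)\<^sup>2 \<le> C * t - ln c" by simp
  also have "\<dots> \<le> \<bar>C\<bar> * t + \<bar>ln c\<bar> * t"
  proof -
    have "C * t \<le> \<bar>C\<bar> * t" using t by (intro mult_right_mono) auto
    moreover have "\<bar>ln c\<bar> * 1 \<le> \<bar>ln c\<bar> * t" using t by (intro mult_left_mono) auto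
    ultimately show ?thesis by linarith
  qed
  also have "\<dots> \<le> t * t"
    using t by (simp add: mult_right_mono flip: distrib_right)
  finally show False using t by (simp add: power2_eq_square algebra_simps)
qed

section \<open>Words and links between states\<close>

definition seg :: "(int \<Rightarrow> nat) \<Rightarrow> int \<Rightarrow> nat \<Rightarrow> nat list" where
  "seg x i n = map (\<lambda>k. x (i + int k)) [0..<n]"

lemma length_seg [simp]: "length (seg x i n) = n"
  by (simp add: seg_def)

lemma nth_seg [simp]: "k < n \<Longrightarrow> seg x i n ! k = x (i + int k)"
  by (simp add: seg_def)

lemma seg_0 [simp]: "seg x i 0 = []"
  by (simp add: seg_def)

lemma seg_eq_iff: "seg x i n = seg y j n \<longleftrightarrow> (\<forall>k<n. x (i + int k) = y (j + int k))"
  by (auto simp: list_eq_iff_nth_eq)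

lemma seg_append: "seg x i m @ seg x (i + int m) n = seg x i (m + n)"
  by (rule nth_equalityI) (auto simp: nth_append algebra_simps)

lemma take_seg: "m \<le> n \<Longrightarrow> take m (seg x i n) = seg x i m"
  by (rule nth_equalityI) auto

lemma drop_seg: "drop m (seg x i n) = seg x (i + int m) (n - m)"
  by (rule nth_equalityI) (auto simp: algebra_simps)

lemma take_append_take: "take n (u @ w) = take n (u @ take n w)"
  by simp

text \<open>
  Used with \<open>P q j\<close> saying that \<open>j\<close> is a possible loop length, or a period, for the state \<open>q\<close>:
  both properties pass to multiples, so finitely many states admit a common value.
\<close>

lemma ex_common_multiple:
  fixes P :: "'a \<Rightarrow> nat \<Rightarrow> bool"
  assumes "finite S"
    and "\<And>q. q \<in> S \<Longrightarrow> \<exists>j>0. P q j"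
    and mult: "\<And>q j k. P q j \<Longrightarrow> 0 < k \<Longrightarrow> P q (k * j)"
  shows "\<exists>l>0. \<forall>q\<in>S. P q l"
  using assms(1,2)
proof (induction S)
  case (insert q S)
  then obtain l j where "0 < l" "\<forall>q\<in>S. P q l" "0 < j" "P q j" by blast
  hence "0 < l * j" "\<forall>q\<in>insert q S. P q (l * j)"
    using mult[of _ l j] mult[of _ j l] by (auto simp: mult.commute)
  thus ?case by blast
qed auto

text \<open>
  A shift of finite type seen through windows of one length \<open>M\<close>: the predicate \<open>ok\<close> says which
  windows may occur.  This replaces forbidden words of various lengths by a local rule of one range.
\<close>

locale window_shift =
  fixes I :: "int set" and \<Lambda> :: "nat set" and M :: nat and ok :: "nat list \<Rightarrow> bool"
    and X :: "(int \<Rightarrow> nat) set"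
  assumes index: "I = {0..} \<or> I = UNIV"
    and finite_alphabet: "finite \<Lambda>"
    and X_eq: "X = {x \<in> I \<rightarrow>\<^sub>E \<Lambda>. \<forall>i\<in>I. ok (seg x i M)}"

lemma shift_of_finite_type_windows:
  assumes "I = {0..} \<or> I = UNIV" "shift_of_finite_type I \<Lambda> X"
  shows "\<exists>M ok. window_shift I \<Lambda> M ok X"
proof -
  obtain W where W: "finite W" "X = {x \<in> I \<rightarrow>\<^sub>E \<Lambda>. \<forall>w\<in>W. \<not> occurs_in I w x}"
    and "finite \<Lambda>"
    using assms(2) by (auto simp: shift_of_finite_type_def)
  define M where "M = (\<Sum>w\<in>W. length w)"
  define ok where "ok u \<longleftrightarrow> (\<forall>w\<in>W. take (length w) u \<noteq> w)" for u :: "nat list"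
  have le: "length w \<le> M" if "w \<in> W" for w
    unfolding M_def using W(1) that by (intro member_le_sum) auto
  have "occurs_in I w x \<longleftrightarrow> (\<exists>i\<in>I. take (length w) (seg x i M) = w)" if "w \<in> W" for w x
    using le[OF that] by (auto simp: occurs_in_def take_seg list_eq_iff_nth_eq)
  hence "X = {x \<in> I \<rightarrow>\<^sub>E \<Lambda>. \<forall>i\<in>I. ok (seg x i M)}"
    unfolding W(2) ok_def by blast
  with \<open>finite \<Lambda>\<close> assms(1) have "window_shift I \<Lambda> M ok X"
    by unfold_locales auto
  thus ?thesis by blast
qed

context window_shift
begin

definition legal :: "nat list \<Rightarrow> bool" where
  "legal u \<longleftrightarrow> set u \<subseteq> \<Lambda> \<and> (\<forall>i. i + M \<le> length u \<longrightarrow> ok (take M (drop i u)))"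

text \<open>
  The state \<open>q\<close> overlaps the word: reading \<open>c\<close> followed by \<open>q'\<close> starts in state
  \<open>q\<close>, passes through allowed windows only, and is in state \<open>q'\<close> after \<open>length c\<close> steps.  Thus links
  are the paths in the graph of states, composition being concatenation of words.
\<close>

definition link :: "nat list \<Rightarrow> nat list \<Rightarrow> nat list \<Rightarrow> bool" where
  "link q c q' \<longleftrightarrow> length q' = M \<and> legal (c @ q') \<and> take M (c @ q') = q"

definition rich :: "nat list \<Rightarrow> bool" where
  "rich q \<longleftrightarrow> (\<exists>d d'. link q d q \<and> link q d' q \<and> length d = length d' \<and> d \<noteq> d')"

lemma richE:
  assumes "rich q"
  obtains d d' where "link q d q" "link q d' q" "length d = length d'" "d \<noteq> d'"
  using assms unfolding rich_def by (elim exE conjE)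

abbreviation T :: "(int \<Rightarrow> nat) \<Rightarrow> int \<Rightarrow> nat" where
  "T \<equiv> shift I"

abbreviation state :: "(int \<Rightarrow> nat) \<Rightarrow> nat \<Rightarrow> nat list" where
  "state x n \<equiv> seg x (int n) M"

definition recurrent :: "(int \<Rightarrow> nat) \<Rightarrow> bool" where
  "recurrent x \<longleftrightarrow> (\<forall>n. \<exists>k\<ge>n. state x k = state x 0)"

lemma link_trans:
  assumes 1: "link q c q'" and 2: "link q' c' q''"
  shows "link q (c @ c') q''"
proof -
  have len: "length q' = M" "length q'' = M"
    and 1: "legal (c @ q')" "take M (c @ q') = q"
    and 2: "legal (c' @ q'')" "take M (c' @ q'') = q'"
    using assms by (auto simp: link_def)
  have ok: "ok (take M (drop i (c @ c' @ q'')))"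
    if i: "i + M \<le> length (c @ c' @ q'')" for i
  proof (cases "i < length c")
    case True
    have drop: "drop i (c @ w) = drop i c @ w" for w using True by simp
    have "take M (drop i (c @ c' @ q'')) = take M (drop i (c @ take M (c' @ q'')))"
      unfolding drop by (rule take_append_take)
    also have "\<dots> = take M (drop i (c @ q'))" by (simp only: 2)
    finally show ?thesis using 1(1) True len by (simp add: legal_def)
  next
    case False
    then obtain j where "i = length c + j" by (metis le_add_diff_inverse not_less)
    thus ?thesis using 2(1) i by (simp add: legal_def)
  qed
  have "take M (c @ c' @ q'') = take M (c @ take M (c' @ q''))"
    by (rule take_append_take)
  also have "\<dots> = q" by (simp only: 1 2)
  finally show ?thesis
    using 1(1) 2(1) ok len unfolding link_def legal_def by (auto simp: 1)
qed

lemma link_power: "link q d q \<Longrightarrow> 0 < n \<Longrightarrow> link q (concat (replicate n d)) q"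
proof (induction n)
  case (Suc n)
  thus ?case by (cases "n = 0") (auto intro: link_trans)
qed simp

lemma link_imp_states: "link q c q' \<Longrightarrow> q \<in> {u. set u \<subseteq> \<Lambda> \<and> length u = M} \<and> q' \<in> {u. set u \<subseteq> \<Lambda> \<and> length u = M}"
  using set_take_subset[of M "c @ q'"] unfolding link_def legal_def by auto

lemma finite_states: "finite {u. set u \<subseteq> \<Lambda> \<and> length u = M}"
  using finite_alphabet by (rule finite_lists_length_eq)

lemma rich_transfer:
  assumes "link q c q'" "link q' c' q" "rich q'"
  shows "rich q"
proof -
  obtain d d' where "link q' d q'" "link q' d' q'" "length d = length d'" "d \<noteq> d'"
    using assms(3) by (rule richE)
  moreover from this have "link q (c @ d @ c') q" "link q (c @ d' @ c') q"
    using link_trans[OF assms(1) link_trans[OF _ assms(2)]] by simp_all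
  ultimately show ?thesis
    unfolding rich_def by (intro exI[of _ "c @ d @ c'"] exI[of _ "c @ d' @ c'"]) simp
qed

text \<open>
  Powers of two different loops of the same length are again different and of the same length.
\<close>

lemma ex_common_loop_length:
  "\<exists>l>0. \<forall>q. rich q \<longrightarrow> (\<exists>d d'. link q d q \<and> link q d' q \<and> length d = l \<and> length d' = l \<and> d \<noteq> d')"
proof -
  let ?P = "\<lambda>q l. \<exists>d d'. link q d q \<and> link q d' q \<and> length d = l \<and> length d' = l \<and> d \<noteq> d'"
  have "\<exists>l>0. \<forall>q\<in>{q. rich q}. ?P q l"
  proof (rule ex_common_multiple)
    show "finite {q. rich q}"
      by (rule finite_subset[OF _ finite_states]) (auto elim!: richE dest: link_imp_states)
    show "\<exists>j>0. ?P q j" if "q \<in> {q. rich q}" for q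
    proof -
      from that have "rich q" by simp
      then obtain d d' where d: "link q d q" "link q d' q" "length d = length d'" "d \<noteq> d'"
        by (rule richE)
      hence "0 < length d" by (cases d) auto
      moreover have "?P q (length d)" using d by (intro exI[of _ d] exI[of _ d']) simp
      ultimately show ?thesis by (intro exI[of _ "length d"] conjI)
    qed
    show "?P q (k * j)" if P: "?P q j" and k: "0 < k" for q j k
    proof -
      obtain d d' where d: "link q d q" "link q d' q" "length d = j" "length d' = j" "d \<noteq> d'"
        using P by blast
      have "concat (replicate k d) \<noteq> concat (replicate k d')"
      proof -
        have "take j (concat (replicate k e)) = e" if "length e = j" for e :: "nat list"
          using k that by (cases k) auto
        from this[OF d(3)] this[OF d(4)] show ?thesis using d(5) by auto
      qed
      moreover have "length (concat (replicate k e)) = k * j" if "length e = j" for e :: "nat list"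
        using that by (induction k) auto
      ultimately show ?thesis
        using d k link_power[of q d k] link_power[of q d' k]
        by (intro exI[of _ "concat (replicate k d)"] exI[of _ "concat (replicate k d')"]) simp
    qed
  qed
  thus ?thesis by auto
qed

text \<open>
  There are only finitely many pairs of states; fix one connecting word for each linked pair.
\<close>

lemma ex_connector_bound:
  "\<exists>G. \<forall>q c q'. link q c q' \<longrightarrow> (\<exists>c. link q c q' \<and> length c \<le> G)"
proof -
  let ?S = "{u. set u \<subseteq> \<Lambda> \<and> length u = M}"
  define short where "short p = (SOME c. link (fst p) c (snd p))" for p
  define G where "G = (\<Sum>p\<in>?S \<times> ?S. length (short p))"
  have "link q (short (q, q')) q' \<and> length (short (q, q')) \<le> G" if "link q c q'" for q c q'
  proof
    show "link q (short (q, q')) q'"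
      using that someI[of "\<lambda>c. link q c q'"] by (simp add: short_def)
    show "length (short (q, q')) \<le> G"
      unfolding G_def using link_imp_states[OF that] finite_states by (intro member_le_sum) auto
  qed
  thus ?thesis by blast
qed

section \<open>Points and their states\<close>

lemma nonneg_in_index: "0 \<le> i \<Longrightarrow> i \<in> I"
  using index by auto

lemma index_add: "i \<in> I \<Longrightarrow> i + int k \<in> I"
  using index by auto

lemma link_point:
  assumes "x \<in> X" "i \<in> I"
  shows "link (seg x i M) (seg x i n) (seg x (i + int n) M)"
proof -
  have "legal (seg x i (n + M))"
    using assms index_add[of i] unfolding X_eq legal_def
    by (auto simp: seg_def drop_seg[unfolded seg_def] take_seg[unfolded seg_def] PiE_mem)
  thus ?thesis by (simp add: link_def seg_append take_seg)
qed

lemma T_power: "x \<in> X \<Longrightarrow> (T ^^ k) x = (\<lambda>i\<in>I. x (i + int k))"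
proof (induction k)
  case 0
  thus ?case by (auto simp: X_eq PiE_def extensional_restrict)
next
  case (Suc k)
  have "T (\<lambda>i\<in>I. x (i + int k)) = (\<lambda>i\<in>I. x (i + int (Suc k)))"
    using index_add[of _ 1] by (auto simp: shift_def algebra_simps)
  moreover have "(T ^^ Suc k) x = T ((T ^^ k) x)" by simp
  ultimately show ?case using Suc by (simp only:)
qed

lemma T_power_nth: "x \<in> X \<Longrightarrow> i \<in> I \<Longrightarrow> (T ^^ k) x i = x (i + int k)"
  by (simp add: T_power)

lemma seg_T_power: "x \<in> X \<Longrightarrow> i \<in> I \<Longrightarrow> seg ((T ^^ k) x) i n = seg x (i + int k) n"
  unfolding seg_def using T_power_nth index_add by (auto simp: algebra_simps)

lemma T_power_in_X: "x \<in> X \<Longrightarrow> (T ^^ k) x \<in> X"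
proof -
  assume x: "x \<in> X"
  have "ok (seg ((T ^^ k) x) i M)" if "i \<in> I" for i
    using x seg_T_power[OF x that] index_add[OF that, of k] by (auto simp: X_eq)
  thus ?thesis using x index_add by (auto simp: X_eq T_power)
qed

lemma T_in_X: "x \<in> X \<Longrightarrow> T x \<in> X"
  using T_power_in_X[of x 1] by simp

lemma X_eqI: "x \<in> X \<Longrightarrow> y \<in> X \<Longrightarrow> (\<And>i. i \<in> I \<Longrightarrow> x i = y i) \<Longrightarrow> x = y"
  unfolding X_eq by (auto intro: PiE_ext)

text \<open>
  If the two futures differed at time \<open>n\<close>, cut both at a return to the initial state later than
  \<open>n\<close>.  The resulting loops \<open>a\<close> and \<open>b\<close> disagree at position \<open>n\<close>, hence so do \<open>a @ b\<close> and
  \<open>b @ a\<close>, two loops of the same length, and the state would be rich.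
\<close>

lemma poor_recurrent_eq:
  assumes x: "x \<in> X" "recurrent x" and y: "y \<in> X" "recurrent y"
    and q: "state x 0 = state y 0" "\<not> rich (state x 0)"
  shows "x (int n) = y (int n)"
proof (rule ccontr)
  assume neq: "x (int n) \<noteq> y (int n)"
  obtain k where k: "k \<ge> Suc n" "state x k = state x 0" using x by (auto simp: recurrent_def)
  obtain l where l: "l \<ge> Suc n" "state y l = state y 0" using y by (auto simp: recurrent_def)
  define a b where "a = seg x 0 k" and "b = seg y 0 l"
  have "link (state x 0) a (state x 0)" "link (state x 0) b (state x 0)"
    using link_point[OF x(1) nonneg_in_index, of 0 k] link_point[OF y(1) nonneg_in_index, of 0 l] k l q
    by (simp_all add: a_def b_def)
  hence "link (state x 0) (a @ b) (state x 0)" "link (state x 0) (b @ a) (state x 0)"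
    by (blast intro: link_trans)+
  moreover have "(a @ b) ! n = x (int n)" "(b @ a) ! n = y (int n)"
    using k l by (simp_all add: a_def b_def nth_append)
  hence "a @ b \<noteq> b @ a" using neq by metis
  moreover have "length (a @ b) = length (b @ a)" by simp
  ultimately show False using q(2) unfolding rich_def by blast
qed

lemma recurrent_return:
  assumes x: "x \<in> X" "recurrent x" and j: "state x j = state x 0"
  shows "recurrent ((T ^^ j) x)" and "state ((T ^^ j) x) 0 = state x 0"
proof -
  have st: "state ((T ^^ j) x) k = state x (k + j)" for k
    using seg_T_power[OF x(1) nonneg_in_index, of "int k" j M] by (simp add: algebra_simps)
  show "state ((T ^^ j) x) 0 = state x 0" using st[of 0] j by simp
  show "recurrent ((T ^^ j) x)"
    unfolding recurrent_def
  proof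
    fix n
    obtain k where k: "k \<ge> n + j" "state x k = state x 0" using x(2) by (auto simp: recurrent_def)
    have "state ((T ^^ j) x) (k - j) = state x 0" using st[of "k - j"] k by simp
    moreover have "state ((T ^^ j) x) 0 = state x 0" using st[of 0] j by simp
    ultimately show "\<exists>k\<ge>n. state ((T ^^ j) x) k = state ((T ^^ j) x) 0"
      using k by (intro exI[of _ "k - j"]) simp
  qed
qed

text \<open>
  After its first return a recurrent point with a poor initial state starts in that same state, so
  by \<open>poor_recurrent_eq\<close> it repeats its own future.  The return time depends only on the state.
\<close>

lemma ex_common_period:
  "\<exists>l>0. \<forall>x\<in>X. recurrent x \<and> \<not> rich (state x 0) \<longrightarrow> (\<forall>n. x (int (n + l)) = x (int n))"
proof -
  let ?P = "\<lambda>q l. \<forall>x\<in>X. recurrent x \<and> \<not> rich q \<and> state x 0 = q \<longrightarrow> (\<forall>n. x (int (n + l)) = x (int n))"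
  have "\<exists>l>0. \<forall>q\<in>{u. set u \<subseteq> \<Lambda> \<and> length u = M}. ?P q l"
  proof (rule ex_common_multiple[OF finite_states])
    fix q
    show "\<exists>l>0. ?P q l"
    proof (cases "\<exists>x\<in>X. recurrent x \<and> \<not> rich q \<and> state x 0 = q")
      case True
      then obtain x where x: "x \<in> X" "recurrent x" "\<not> rich q" "state x 0 = q" by blast
      obtain j where j: "j \<ge> 1" "state x j = state x 0" using x by (auto simp: recurrent_def)
      have "y (int (n + j)) = y (int n)" if y: "y \<in> X" "recurrent y" "state y 0 = q" for y n
      proof -
        have eq: "x (int n) = y (int n)" for n
          using x y by (intro poor_recurrent_eq) auto
        have "(T ^^ j) x (int n) = x (int n)"
          using x j recurrent_return[OF x(1,2) j(2)] T_power_in_X[OF x(1)]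
          by (intro poor_recurrent_eq) auto
        thus ?thesis using T_power_nth[OF x(1) nonneg_in_index, of "int n" j] eq[of n] eq[of "n + j"]
          by simp
      qed
      thus ?thesis using j by (intro exI[of _ j]) auto
    qed (auto intro: exI[of _ 1])
  next
    fix q j and k :: nat assume P: "?P q j"
    show "?P q (k * j)"
    proof (intro ballI impI allI)
      fix x n assume x: "x \<in> X" "recurrent x \<and> \<not> rich q \<and> state x 0 = q"
      show "x (int (n + k * j)) = x (int n)"
      proof (induction k)
        case (Suc k)
        have "x (int ((n + k * j) + j)) = x (int (n + k * j))" using P x by blast
        thus ?case using Suc by (simp add: algebra_simps)
      qed simp
    qed
  qed
  then obtain l where "0 < l" and l: "\<forall>q\<in>{u. set u \<subseteq> \<Lambda> \<and> length u = M}. ?P q l" by blast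
  moreover have "state x 0 \<in> {u. set u \<subseteq> \<Lambda> \<and> length u = M}" if "x \<in> X" for x
    using link_imp_states[OF link_point[OF that nonneg_in_index, of 0 0]] by simp
  ultimately show ?thesis by blast
qed

end

section \<open>Entropy of partitions\<close>

text \<open>
  The entropy function, with \<open>eta 0 = 0\<close> because \<open>ln 0 = 0\<close>.
\<close>

definition eta :: "real \<Rightarrow> real" where
  "eta s = - (s * ln s)"

lemma eta_0 [simp]: "eta 0 = 0"
  by (simp add: eta_def)

lemma eta_nonneg: "0 \<le> s \<Longrightarrow> s \<le> 1 \<Longrightarrow> 0 \<le> eta s"
  by (cases "s = 0") (auto simp: eta_def mult_nonneg_nonpos)

lemma eta_le_1: "0 \<le> s \<Longrightarrow> eta s \<le> 1"
proof (cases "s = 0")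
  case False
  assume "0 \<le> s"
  hence s: "0 < s" using False by simp
  have "ln (1 / s) \<le> 1 / s - 1" using s by (intro ln_le_minus_one) simp
  hence "s * ln (1 / s) \<le> s * (1 / s - 1)" using s by (intro mult_left_mono) auto
  thus ?thesis using s by (simp add: eta_def ln_div algebra_simps)
qed simp

lemma eta_add_le:
  assumes "0 \<le> x" "0 \<le> y"
  shows "eta (x + y) \<le> eta x + eta y"
proof -
  have "s * ln s \<le> s * ln (s + r)" if "0 \<le> s" "0 \<le> r" for s r :: real
    using that by (cases "s = 0") (auto intro!: mult_left_mono)
  from this[of x y] this[of y x] show ?thesis
    using assms by (simp add: eta_def algebra_simps)
qed

lemma eta_mult: "0 \<le> x \<Longrightarrow> 0 \<le> y \<Longrightarrow> eta (x * y) = x * eta y + y * eta x"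
  by (cases "x = 0 \<or> y = 0") (auto simp: eta_def ln_mult algebra_simps)

lemma partition_entropy_eta: "partition_entropy M P = (\<Sum>A\<in>P. eta (measure M A))"
  by (simp add: partition_entropy_def eta_def sum_negf)

lemma partition_entropy_nonneg: "prob_space M \<Longrightarrow> 0 \<le> partition_entropy M P"
  unfolding partition_entropy_eta
  by (intro sum_nonneg eta_nonneg) (auto simp: prob_space.prob_le_1)

lemma entropy_of_partition_nonneg:
  assumes "prob_space M"
  shows "0 \<le> entropy_of_partition M T P"
  unfolding entropy_of_partition_def
  using partition_entropy_nonneg[OF assms]
  by (intro Liminf_bounded always_eventually allI) simp

lemma ks_entropy_nonneg:
  assumes "prob_space M"
  shows "0 \<le> ks_entropy M T"
proof -
  interpret prob_space M by fact
  have "0 \<le> entropy_of_partition M T {space M}"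
    by (rule entropy_of_partition_nonneg[OF assms])
  also have "\<dots> \<le> ks_entropy M T"
    unfolding ks_entropy_def using not_empty
    by (intro SUP_upper) (auto simp: partition_on_def disjoint_def)
  finally show ?thesis .
qed

lemma measurable_funpow: "T \<in> measurable M M \<Longrightarrow> (T ^^ n) \<in> measurable M M"
  by (induction n) (auto intro: measurable_comp simp: id_def)

lemma refined_partition_props:
  assumes T: "T \<in> measurable M M" and P: "finite P" "P \<subseteq> sets M" "partition_on (space M) P"
  shows "finite (refined_partition M T P n)"
    and "refined_partition M T P n \<subseteq> sets M"
    and "disjoint (refined_partition M T P n)"
    and "\<Union>(refined_partition M T P n) = space M"
proof -
  let ?atom = "\<lambda>A. {x \<in> space M. \<forall>i<n. (T ^^ i) x \<in> A i}"
  show "finite (refined_partition M T P n)"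
    unfolding refined_partition_def using P(1) by (intro finite_imageI finite_PiE) auto
  show "refined_partition M T P n \<subseteq> sets M"
    unfolding refined_partition_def
  proof (intro image_subsetI)
    fix A assume A: "A \<in> {..<n} \<rightarrow>\<^sub>E P"
    have "{x \<in> space M. \<forall>i\<in>{..<n}. (T ^^ i) x \<in> A i} \<in> sets M"
    proof (rule sets.sets_Collect_finite_All)
      fix i assume "i \<in> {..<n}"
      hence "A i \<in> sets M" using A P(2) by (auto dest: PiE_mem)
      thus "{x \<in> space M. (T ^^ i) x \<in> A i} \<in> sets M"
        using measurable_sets[OF measurable_funpow[OF T, of i], of "A i"]
        by (simp add: vimage_def Int_def conj_commute)
    qed simp
    thus "?atom A \<in> sets M" by (simp only: Ball_def lessThan_iff)
  qed
  have in_space: "(T ^^ i) x \<in> space M" if "x \<in> space M" for x i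
    using measurable_space[OF measurable_funpow[OF T]] that by blast
  have disjP: "p = p'" if "p \<in> P" "p' \<in> P" "y \<in> p" "y \<in> p'" for p p' y
    using partition_onD2[OF P(3)] that unfolding disjoint_def by blast
  show "disjoint (refined_partition M T P n)"
    unfolding refined_partition_def disjoint_def
  proof (intro ballI impI)
    fix U V assume "U \<in> ?atom ` ({..<n} \<rightarrow>\<^sub>E P)" "V \<in> ?atom ` ({..<n} \<rightarrow>\<^sub>E P)" "U \<noteq> V"
    then obtain A B where A: "A \<in> {..<n} \<rightarrow>\<^sub>E P" "U = ?atom A" and B: "B \<in> {..<n} \<rightarrow>\<^sub>E P" "V = ?atom B"
      by blast
    show "U \<inter> V = {}"
    proof (rule ccontr)
      assume "U \<inter> V \<noteq> {}"
      then obtain x where "x \<in> U" "x \<in> V" by blast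
      hence "A i = B i" if "i \<in> {..<n}" for i
        using disjP[of "A i" "B i" "(T ^^ i) x"] that A B by (auto dest: PiE_mem)
      hence "A = B" using A(1) B(1) by (intro PiE_ext)
      thus False using \<open>U \<noteq> V\<close> A B by simp
    qed
  qed
  show "\<Union>(refined_partition M T P n) = space M"
  proof
    show "space M \<subseteq> \<Union>(refined_partition M T P n)"
    proof
      fix x assume x: "x \<in> space M"
      have "\<exists>p\<in>P. (T ^^ i) x \<in> p" for i
        using P(3) in_space[OF x] by (auto simp: partition_on_def)
      then obtain p where p: "\<And>i. p i \<in> P" "\<And>i. (T ^^ i) x \<in> p i" by metis
      have "restrict p {..<n} \<in> {..<n} \<rightarrow>\<^sub>E P" using p by auto
      moreover have "x \<in> ?atom (restrict p {..<n})" using x p by auto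
      ultimately show "x \<in> \<Union>(refined_partition M T P n)"
        unfolding refined_partition_def by blast
    qed
  qed (auto simp: refined_partition_def)
qed

lemma sum_measure_Int_partition:
  assumes "finite_measure M" "finite P" "P \<subseteq> sets M" "disjoint P" "\<Union>P = space M" "B \<in> sets M"
  shows "(\<Sum>A\<in>P. measure M (A \<inter> B)) = measure M B"
proof -
  interpret finite_measure M by fact
  have "measure M (\<Union>A\<in>P. A \<inter> B) = (\<Sum>A\<in>P. measure M (A \<inter> B))"
  proof (rule finite_measure_finite_Union)
    show "disjoint_family_on (\<lambda>A. A \<inter> B) P"
      using assms(4) unfolding disjoint_family_on_def disjoint_def by blast
    show "(\<lambda>A. A \<inter> B) ` P \<subseteq> sets M" using assms(3,6) by auto
  qed fact
  moreover have "(\<Union>A\<in>P. A \<inter> B) = B"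
    using assms(5) sets.sets_into_space[OF assms(6)] by auto
  ultimately show ?thesis by simp
qed

lemma entropy_ge_of_small_atoms:
  assumes "prob_space M" "finite P" "P \<subseteq> sets M" "disjoint P" "\<Union>P = space M"
    and c: "0 < c" and small: "\<And>A. A \<in> P \<Longrightarrow> measure M A \<le> c"
  shows "- ln c \<le> partition_entropy M P"
proof -
  interpret prob_space M by fact
  have "(\<Sum>A\<in>P. measure M A) = (\<Sum>A\<in>P. measure M (A \<inter> space M))"
    using assms(3) by (intro sum.cong refl arg_cong[of _ _ "measure M"]) (auto dest: sets.sets_into_space)
  also have "\<dots> = 1"
    using sum_measure_Int_partition[OF finite_measure_axioms assms(2-5) sets.top] prob_space by simp
  finally have "- ln c = (\<Sum>A\<in>P. measure M A) * - ln c" by simp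
  also have "\<dots> = (\<Sum>A\<in>P. measure M A * - ln c)" by (rule sum_distrib_right)
  also have "\<dots> \<le> (\<Sum>A\<in>P. eta (measure M A))"
  proof (rule sum_mono)
    fix A assume "A \<in> P"
    show "measure M A * - ln c \<le> eta (measure M A)"
    proof (cases "measure M A = 0")
      case False
      hence "0 < measure M A" by (simp add: zero_less_measure_iff)
      hence "ln (measure M A) \<le> ln c" using small[OF \<open>A \<in> P\<close>] c by simp
      thus ?thesis by (auto simp: eta_def intro!: mult_left_mono)
    qed simp
  qed
  finally show ?thesis by (simp add: partition_entropy_eta)
qed

lemma measure_uniform_measure_mult:
  assumes "finite_measure M" "R \<in> sets M" "B \<in> sets M"
  shows "measure M (B \<inter> R) = measure M R * measure (uniform_measure M R) B"
proof -
  interpret finite_measure M by fact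
  show ?thesis
  proof (cases "measure M R = 0")
    case True
    have "measure M (B \<inter> R) \<le> measure M R" using assms by (intro finite_measure_mono) auto
    thus ?thesis using True measure_nonneg[of M "B \<inter> R"] by simp
  next
    case False
    hence "emeasure M R \<noteq> 0" by (auto simp: measure_def)
    thus ?thesis using assms False by (subst measure_uniform_measure) (auto simp: Int_commute)
  qed
qed

text \<open>
  The itinerary of a point of period \<open>l\<close> is determined by its first \<open>l\<close> entries, so the bound does
  not depend on \<open>n\<close>.
\<close>

lemma few_atoms_meet_periodic:
  assumes T: "T \<in> measurable M M" and P: "finite P" "P \<subseteq> sets M" "partition_on (space M) P"
    and Q: "Q \<subseteq> space M" "\<And>x. x \<in> Q \<Longrightarrow> (T ^^ l) x = x" and l: "0 < l"
  shows "card {A \<in> refined_partition M T P n. A \<inter> Q \<noteq> {}} \<le> card P ^ l"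
proof -
  let ?f = "\<lambda>a. {x \<in> space M. \<forall>i<n. (T ^^ i) x \<in> a (i mod l)}"
  have "{A \<in> refined_partition M T P n. A \<inter> Q \<noteq> {}} \<subseteq> ?f ` ({..<l} \<rightarrow>\<^sub>E P)"
  proof (intro subsetI)
    fix A assume "A \<in> {A \<in> refined_partition M T P n. A \<inter> Q \<noteq> {}}"
    then obtain B y where B: "B \<in> {..<n} \<rightarrow>\<^sub>E P" "A = {x \<in> space M. \<forall>i<n. (T ^^ i) x \<in> B i}"
      and y: "y \<in> A" "y \<in> Q"
      by (auto simp: refined_partition_def)
    have "y \<in> space M" using y Q by blast
    hence "(T ^^ i) y \<in> space M" for i
      using measurable_space[OF measurable_funpow[OF T]] by blast
    hence "\<exists>p\<in>P. (T ^^ i) y \<in> p" for i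
      using P(3) by (auto simp: partition_on_def)
    then obtain p where p: "\<And>i. p i \<in> P" "\<And>i. (T ^^ i) y \<in> p i" by metis
    have "B i = p (i mod l)" if "i < n" for i
    proof -
      have "(T ^^ i) y \<in> B i" "B i \<in> P" using y B that by (auto dest: PiE_mem)
      moreover have "(T ^^ i) y \<in> p (i mod l)"
        using p(2)[of "i mod l"] funpow_mod_eq[OF Q(2)[OF y(2)], of i] by simp
      ultimately show ?thesis
        using partition_onD2[OF P(3)] p(1)[of "i mod l"] unfolding disjoint_def by blast
    qed
    hence "A = ?f (restrict p {..<l})" unfolding B(2) using l by auto
    moreover have "restrict p {..<l} \<in> {..<l} \<rightarrow>\<^sub>E P" using p by auto
    ultimately show "A \<in> ?f ` ({..<l} \<rightarrow>\<^sub>E P)" by blast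
  qed
  hence "card {A \<in> refined_partition M T P n. A \<inter> Q \<noteq> {}} \<le> card (?f ` ({..<l} \<rightarrow>\<^sub>E P))"
    using P(1) by (intro card_mono finite_imageI finite_PiE) auto
  also have "\<dots> \<le> card ({..<l} \<rightarrow>\<^sub>E P)" using P(1) by (intro card_image_le finite_PiE) auto
  also have "\<dots> = card P ^ l" by (simp add: card_PiE)
  finally show ?thesis .
qed

text \<open>
  By subadditivity of \<open>eta\<close>, splitting every atom into its parts in \<open>R\<close> and in \<open>Q\<close> does not
  decrease the entropy.  The parts in \<open>Q\<close> contribute at most their number, which stays bounded by
  \<open>few_atoms_meet_periodic\<close> and vanishes after division by \<open>n\<close>; the parts in \<open>R\<close> give the
  conditional entropy.  If \<open>R\<close> is null, the conditional measure is zero and so is its entropy.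
\<close>

lemma entropy_of_partition_off_periodic:
  assumes "prob_space M" and T: "T \<in> measurable M M"
    and P: "finite P" "P \<subseteq> sets M" "partition_on (space M) P"
    and Q: "Q \<in> sets M" "\<And>x. x \<in> Q \<Longrightarrow> (T ^^ l) x = x" and l: "0 < l"
  defines "R \<equiv> space M - Q"
  shows "entropy_of_partition M T P
           \<le> ereal (measure M R) * entropy_of_partition (uniform_measure M R) T P"
proof -
  interpret prob_space M by fact
  have R: "R \<in> sets M" using Q by (auto simp: R_def)
  have refined_eq: "refined_partition (uniform_measure M R) T P n = refined_partition M T P n" for n
    by (simp add: refined_partition_def)
  define H where "H n = partition_entropy (uniform_measure M R) (refined_partition M T P n)" for n
  define K where "K = 1 + real (card P ^ l)"
  have bound: "partition_entropy M (refined_partition M T P n) \<le> K + measure M R * H n" for n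
  proof -
    define P' where "P' = refined_partition M T P n"
    note P' = refined_partition_props[OF T P, of n, folded P'_def]
    have "partition_entropy M P' = (\<Sum>A\<in>P'. eta (measure M (A \<inter> R) + measure M (A \<inter> Q)))"
      unfolding partition_entropy_eta
    proof (intro sum.cong refl arg_cong[of _ _ eta])
      fix A assume "A \<in> P'"
      hence A: "A \<in> sets M" using P' by blast
      have "A = (A \<inter> R) \<union> (A \<inter> Q)" using sets.sets_into_space[OF A] by (auto simp: R_def)
      thus "measure M A = measure M (A \<inter> R) + measure M (A \<inter> Q)"
        using finite_measure_Union[of "A \<inter> R" "A \<inter> Q"] A R Q by (auto simp: R_def)
    qed
    also have "\<dots> \<le> (\<Sum>A\<in>P'. eta (measure M (A \<inter> R)) + eta (measure M (A \<inter> Q)))"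
      by (intro sum_mono eta_add_le) auto
    also have "\<dots> = (\<Sum>A\<in>P'. eta (measure M (A \<inter> R))) + (\<Sum>A\<in>P'. eta (measure M (A \<inter> Q)))"
      by (rule sum.distrib)
    also have "(\<Sum>A\<in>P'. eta (measure M (A \<inter> R)))
        = (\<Sum>A\<in>P'. measure M R * eta (measure (uniform_measure M R) A)
                    + measure (uniform_measure M R) A * eta (measure M R))"
    proof (intro sum.cong refl)
      fix A assume "A \<in> P'"
      hence A: "A \<in> sets M" using P' by blast
      show "eta (measure M (A \<inter> R)) = measure M R * eta (measure (uniform_measure M R) A)
                    + measure (uniform_measure M R) A * eta (measure M R)"
        by (simp add: measure_uniform_measure_mult[OF finite_measure_axioms R A] eta_mult)
    qed
    also have "\<dots> = measure M R * H n + (\<Sum>A\<in>P'. measure (uniform_measure M R) A) * eta (measure M R)"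
      by (simp add: H_def P'_def[symmetric] partition_entropy_eta sum.distrib sum_distrib_left sum_distrib_right)
    also have "(\<Sum>A\<in>P'. measure (uniform_measure M R) A) * eta (measure M R) \<le> 1"
    proof (cases "measure M R = 0")
      case False
      have "measure M R * (\<Sum>A\<in>P'. measure (uniform_measure M R) A) = (\<Sum>A\<in>P'. measure M (A \<inter> R))"
        unfolding sum_distrib_left using P'(2)
        by (intro sum.cong refl measure_uniform_measure_mult[OF finite_measure_axioms R, symmetric]) auto
      also have "\<dots> = measure M R"
        using sum_measure_Int_partition[OF finite_measure_axioms P' R] .
      finally have "(\<Sum>A\<in>P'. measure (uniform_measure M R) A) = 1" using False by simp
      thus ?thesis using eta_le_1[of "measure M R"] by simp
    qed simp
    also have "(\<Sum>A\<in>P'. eta (measure M (A \<inter> Q))) = (\<Sum>A\<in>{A\<in>P'. A \<inter> Q \<noteq> {}}. eta (measure M (A \<inter> Q)))"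
      using P' by (intro sum.mono_neutral_right) auto
    also have "\<dots> \<le> real (card {A\<in>P'. A \<inter> Q \<noteq> {}}) * 1"
      by (intro sum_bounded_above eta_le_1) auto
    also have "\<dots> \<le> real (card P ^ l)"
      using few_atoms_meet_periodic[OF T P sets.sets_into_space[OF Q(1)] Q(2) l, of n]
      unfolding P'_def by simp
    finally show ?thesis by (simp add: P'_def K_def)
  qed
  have "entropy_of_partition M T P
      \<le> liminf (\<lambda>n. ereal (K / real n) + ereal (measure M R) * ereal (H n / real n))"
    unfolding entropy_of_partition_def
  proof (intro Liminf_mono always_eventually allI)
    fix n
    have "partition_entropy M (refined_partition M T P n) / real n
        \<le> (K + measure M R * H n) / real n"
      by (intro divide_right_mono bound) simp
    thus "ereal (partition_entropy M (refined_partition M T P n) / real n)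
      \<le> ereal (K / real n) + ereal (measure M R) * ereal (H n / real n)"
      by (simp add: add_divide_distrib)
  qed
  also have "\<dots> = 0 + liminf (\<lambda>n. ereal (measure M R) * ereal (H n / real n))"
  proof (rule ereal_liminf_lim_add)
    have "(\<lambda>n. K / real n) \<longlonglongrightarrow> 0" by (rule lim_const_over_n)
    thus "(\<lambda>n. ereal (K / real n)) \<longlonglongrightarrow> 0" by (simp add: zero_ereal_def)
  qed simp
  also have "liminf (\<lambda>n. ereal (measure M R) * ereal (H n / real n))
      = ereal (measure M R) * liminf (\<lambda>n. ereal (H n / real n))"
    by (rule Liminf_ereal_mult_left) simp_all
  finally show ?thesis
    by (simp add: entropy_of_partition_def refined_eq H_def)
qed

lemma ks_entropy_off_periodic:
  assumes "prob_space M" and T: "T \<in> measurable M M"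
    and Q: "Q \<in> sets M" "\<And>x. x \<in> Q \<Longrightarrow> (T ^^ l) x = x" and l: "0 < l"
  defines "R \<equiv> space M - Q"
  shows "ks_entropy M T \<le> ereal (measure M R) * ks_entropy (uniform_measure M R) T"
  unfolding ks_entropy_def[of M]
proof (rule SUP_least)
  fix P assume P: "P \<in> {P. finite P \<and> P \<subseteq> sets M \<and> partition_on (space M) P}"
  hence "entropy_of_partition M T P
           \<le> ereal (measure M R) * entropy_of_partition (uniform_measure M R) T P"
    unfolding R_def using entropy_of_partition_off_periodic[OF assms(1) T _ _ _ Q l] by blast
  also have "\<dots> \<le> ereal (measure M R) * ks_entropy (uniform_measure M R) T"
    using P unfolding ks_entropy_def by (intro ereal_mult_left_mono SUP_upper) auto
  finally show "entropy_of_partition M T P \<le> ereal (measure M R) * ks_entropy (uniform_measure M R) T" .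
qed

section \<open>Invariant measures and recurrence\<close>

lemma AE_of_equal_measure:
  assumes "finite_measure M" "A \<in> sets M" "B \<in> sets M" "A \<subseteq> B" "emeasure M A = emeasure M B"
  shows "AE x in M. x \<in> B \<longrightarrow> x \<in> A"
proof -
  interpret finite_measure M by fact
  have "emeasure M (B - A) = 0"
    using assms by (subst emeasure_Diff) auto
  hence "B - A \<in> null_sets M" using assms by auto
  thus ?thesis by (rule AE_I') auto
qed

text \<open>
  Both Poincare recurrence and the passage from forward periodic to periodic points rest on this:
  if the sets of a decreasing sequence have equal measure, almost nothing is ever lost.
\<close>

lemma AE_antimono_equal_measure:
  assumes "finite_measure M" "\<And>n. U n \<in> sets M" "\<And>n::nat. U (Suc n) \<subseteq> U n"
    "\<And>n. emeasure M (U (Suc n)) = emeasure M (U n)"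
  shows "AE x in M. x \<in> U 0 \<longrightarrow> (\<forall>n. x \<in> U n)"
proof -
  have "AE x in M. x \<in> U n \<longrightarrow> x \<in> U (Suc n)" for n
    using assms(1) assms(2) assms(2) assms(3) assms(4) by (rule AE_of_equal_measure)
  hence "AE x in M. \<forall>n. x \<in> U n \<longrightarrow> x \<in> U (Suc n)"
    by (simp add: AE_all_countable)
  thus ?thesis
  proof eventually_elim
    case (elim x)
    show ?case
    proof (intro impI allI)
      fix n assume "x \<in> U 0" thus "x \<in> U n" by (induction n) (use elim in auto)
    qed
  qed
qed

lemma emeasure_vimage_invariant:
  assumes "T \<in> measurable M M" "distr M M T = M" "A \<in> sets M"
  shows "emeasure M (T -` A \<inter> space M) = emeasure M A"
  using emeasure_distr[OF assms(1,3)] assms(2) by simp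

text \<open>
  The set of points that visit \<open>A\<close> at time \<open>n + 1\<close> or later is the preimage of the set of points
  that visit it at time \<open>n\<close> or later.
\<close>

lemma poincare_recurrence:
  assumes "finite_measure M" and T: "T \<in> measurable M M" "distr M M T = M" and A: "A \<in> sets M"
  shows "AE x in M. x \<in> A \<longrightarrow> (\<forall>n. \<exists>k\<ge>n. (T ^^ k) x \<in> A)"
proof -
  define U where "U n = {x \<in> space M. \<exists>k\<ge>n. (T ^^ k) x \<in> A}" for n
  have U: "U n \<in> sets M" for n
  proof -
    have "U n = (\<Union>k\<in>{n..}. (T ^^ k) -` A \<inter> space M)" by (auto simp: U_def)
    also have "\<dots> \<in> sets M"
      by (intro sets.countable_UN'' measurable_sets[OF measurable_funpow[OF T(1)] A]) auto
    finally show ?thesis .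
  qed
  have "AE x in M. x \<in> U 0 \<longrightarrow> (\<forall>n. x \<in> U n)"
  proof (rule AE_antimono_equal_measure[OF assms(1) U])
    fix n
    show "U (Suc n) \<subseteq> U n" by (auto simp: U_def dest: Suc_leD)
    have "U (Suc n) = T -` U n \<inter> space M"
    proof (intro set_eqI iffI)
      fix x assume "x \<in> U (Suc n)"
      then obtain k where "k \<ge> Suc n" "(T ^^ k) x \<in> A" "x \<in> space M" by (auto simp: U_def)
      hence "k - 1 \<ge> n" "(T ^^ (k - 1)) (T x) \<in> A"
        by (cases k; simp add: funpow_swap1)+
      thus "x \<in> T -` U n \<inter> space M"
        using \<open>x \<in> space M\<close> measurable_space[OF T(1)] by (auto simp: U_def)
    next
      fix x assume "x \<in> T -` U n \<inter> space M"
      then obtain k where "k \<ge> n" "(T ^^ k) (T x) \<in> A" "x \<in> space M" by (auto simp: U_def)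
      thus "x \<in> U (Suc n)" by (auto simp: U_def funpow_swap1 intro!: exI[of _ "Suc k"])
    qed
    thus "emeasure M (U (Suc n)) = emeasure M (U n)"
      using emeasure_vimage_invariant[OF T U] by simp
  qed
  thus ?thesis
    using AE_space
  proof eventually_elim
    case (elim x)
    thus ?case by (force simp: U_def intro: exI[of _ 0])
  qed
qed

lemma uniform_measure_invariant:
  assumes "prob_space M" and T: "T \<in> measurable M M" "distr M M T = M" and R: "R \<in> sets M"
    and inv: "AE x in M. T x \<in> R \<longleftrightarrow> x \<in> R" and pos: "measure M R \<noteq> 0"
  shows "prob_space (uniform_measure M R)"
    and "T \<in> measurable (uniform_measure M R) (uniform_measure M R)"
    and "distr (uniform_measure M R) (uniform_measure M R) T = uniform_measure M R"
proof -
  interpret prob_space M by fact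
  have "emeasure M R \<noteq> 0" using pos by (auto simp: measure_def)
  thus "prob_space (uniform_measure M R)" by (intro prob_space_uniform_measure) auto
  show T': "T \<in> measurable (uniform_measure M R) (uniform_measure M R)"
    using T(1) by (simp cong: measurable_cong_sets)
  show "distr (uniform_measure M R) (uniform_measure M R) T = uniform_measure M R"
  proof (rule measure_eqI)
    fix B assume "B \<in> sets (distr (uniform_measure M R) (uniform_measure M R) T)"
    hence B: "B \<in> sets M" by simp
    have pre: "T -` C \<inter> space M \<in> sets M" if "C \<in> sets M" for C
      using measurable_sets[OF T(1) that] .
    have "emeasure M (R \<inter> (T -` B \<inter> space M)) = emeasure M (T -` (R \<inter> B) \<inter> space M)"
      using inv R B pre[OF B] pre[of "R \<inter> B"] by (intro emeasure_eq_AE) auto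
    also have "\<dots> = emeasure M (R \<inter> B)"
      using R B by (intro emeasure_vimage_invariant T) auto
    finally show "emeasure (distr (uniform_measure M R) (uniform_measure M R) T) B
        = emeasure (uniform_measure M R) B"
      using R B pre[OF B] by (subst emeasure_distr[OF T']) auto
  qed simp
qed

lemma integral_uniform_measure_mult:
  fixes f :: "'a \<Rightarrow> real"
  assumes "finite_measure M" and R: "R \<in> sets M" and f: "f \<in> borel_measurable M"
    and pos: "measure M R \<noteq> 0"
  shows "measure M R * (\<integral>x. f x \<partial>uniform_measure M R) = (\<integral>x. indicator R x * f x \<partial>M)"
proof -
  interpret finite_measure M by fact
  have "uniform_measure M R = density M (\<lambda>x. ennreal (indicator R x / measure M R))"
  proof -
    have "0 < measure M R" using pos by (simp add: zero_less_measure_iff)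
    hence "indicator R x / emeasure M R = ennreal (indicator R x / measure M R)" for x
      using divide_ennreal[of 1 "measure M R"]
      by (auto simp: emeasure_eq_measure split: split_indicator)
    thus ?thesis by (simp add: uniform_measure_def)
  qed
  hence "(\<integral>x. f x \<partial>uniform_measure M R) = (\<integral>x. (indicator R x / measure M R) * f x \<partial>M)"
    using R f by (simp add: integral_density)
  also have "\<dots> = (\<integral>x. (indicator R x * f x) / measure M R \<partial>M)" by simp
  also have "\<dots> = (\<integral>x. indicator R x * f x \<partial>M) / measure M R" by (rule integral_divide_zero)
  finally show ?thesis using pos by simp
qed

lemma integral_funpow_invariant:
  fixes f :: "'a \<Rightarrow> real"
  assumes T: "T \<in> measurable M M" "distr M M T = M" and f: "f \<in> borel_measurable M"
  shows "(\<integral>x. f ((T ^^ n) x) \<partial>M) = (\<integral>x. f x \<partial>M)"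
proof (induction n)
  case (Suc n)
  have "(\<integral>x. f ((T ^^ n) x) \<partial>distr M M T) = (\<integral>x. f ((T ^^ n) (T x)) \<partial>M)"
    using T(1) measurable_compose[OF measurable_funpow[OF T(1)] f] by (rule integral_distr)
  thus ?case using Suc by (simp add: T(2) funpow_swap1)
qed simp

section \<open>Hoelder potentials on the shift space\<close>

text \<open>
  Points that agree on all indices of absolute value less than \<open>k\<close> are at distance at most
  \<open>2 powr - k\<close>, so \<open>\<theta> = 2 powr - h\<close>.
\<close>

lemma hoelder_potential_geometric:
  assumes X: "X \<subseteq> I \<rightarrow>\<^sub>E \<Lambda>" and "hoelder_potential I X \<phi>"
  shows "\<exists>C \<theta>. 0 \<le> C \<and> 0 < \<theta> \<and> \<theta> < 1 \<and>
           (\<forall>x\<in>X. \<forall>y\<in>X. \<forall>k. (\<forall>i\<in>I. \<bar>i\<bar> < int k \<longrightarrow> x i = y i) \<longrightarrow> \<bar>\<phi> x - \<phi> y\<bar> \<le> C * \<theta> ^ k)"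
proof -
  obtain h C where h: "0 < h" and C: "\<forall>x\<in>X. \<forall>y\<in>X. \<bar>\<phi> x - \<phi> y\<bar> \<le> C * sdist I x y powr h"
    using assms(2) by (auto simp: hoelder_potential_def)
  define \<theta> :: real where "\<theta> = 2 powr - h"
  have \<theta>: "0 < \<theta>" "\<theta> < 1" using h by (auto simp: \<theta>_def powr_less_one)
  have "\<bar>\<phi> x - \<phi> y\<bar> \<le> \<bar>C\<bar> * \<theta> ^ k"
    if xy: "x \<in> X" "y \<in> X" and agree: "\<forall>i\<in>I. \<bar>i\<bar> < int k \<longrightarrow> x i = y i" for x y k
  proof (cases "x = y")
    case False
    then obtain i where i: "i \<in> I" "x i \<noteq> y i" "x \<noteq> y"
      using PiE_ext[of x I "\<lambda>_. \<Lambda>" y] xy X by blast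
    let ?P = "\<lambda>n. \<exists>i\<in>I. nat \<bar>i\<bar> = n \<and> x i \<noteq> y i"
    have "?P (first_diff I x y)"
      unfolding first_diff_def by (rule LeastI[of ?P "nat \<bar>i\<bar>"]) (use i in blast)
    hence "k \<le> first_diff I x y" using agree by force
    hence "sdist I x y \<le> 2 powr - real k"
      using i by (simp add: sdist_def)
    hence "sdist I x y powr h \<le> (2 powr - real k) powr h"
      using h by (intro powr_mono2) (auto simp: sdist_def)
    also have "\<dots> = \<theta> ^ k"
      by (simp add: \<theta>_def powr_powr mult.commute flip: powr_realpow)
    finally have "C * sdist I x y powr h \<le> \<bar>C\<bar> * \<theta> ^ k"
      by (intro mult_mono) auto
    thus ?thesis using C xy by force
  qed (use \<theta> in simp)
  thus ?thesis using \<theta> by (intro exI[of _ "\<bar>C\<bar>"] exI[of _ \<theta>]) auto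
qed

context window_shift
begin

lemma in_alphabet: "x \<in> X \<Longrightarrow> i \<in> I \<Longrightarrow> x i \<in> \<Lambda>"
  by (auto simp: X_eq PiE_mem)

abbreviation S :: "(int \<Rightarrow> nat) measure" where
  "S \<equiv> shift_space I \<Lambda> X"

lemma space_S [simp]: "space S = X"
  unfolding shift_space_def by (auto simp: space_restrict_space space_PiM X_eq)

lemma measurable_coordinate: "i \<in> I \<Longrightarrow> (\<lambda>x. x i) \<in> measurable S (count_space \<Lambda>)"
  unfolding shift_space_def
  by (intro measurable_restrict_space1 measurable_component_singleton)

lemma measurable_into_S:
  assumes "\<And>\<omega>. \<omega> \<in> space N \<Longrightarrow> f \<omega> \<in> X"
    and "\<And>i. i \<in> I \<Longrightarrow> (\<lambda>\<omega>. f \<omega> i) \<in> measurable N (count_space \<Lambda>)"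
  shows "f \<in> measurable N S"
  unfolding shift_space_def
proof (rule measurable_restrict_space2)
  show "f \<in> space N \<rightarrow> X" using assms(1) by blast
  show "f \<in> measurable N (PiM I (\<lambda>i. count_space \<Lambda>))"
    using assms unfolding X_eq by (intro measurable_PiM_single') auto
qed

lemma T_nth: "i \<in> I \<Longrightarrow> T x i = x (i + 1)"
  by (simp add: shift_def)

lemma measurable_T: "T \<in> measurable S S"
proof (rule measurable_into_S)
  fix i assume i: "i \<in> I"
  have "(\<lambda>x. x (i + 1)) \<in> measurable S (count_space \<Lambda>)"
    using index_add[OF i, of 1] by (intro measurable_coordinate) simp
  thus "(\<lambda>x. T x i) \<in> measurable S (count_space \<Lambda>)"
    using i by (simp add: T_nth)
qed (simp add: T_in_X)

lemma cylinder_in_sets: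
  assumes "J \<subseteq> I"
  shows "{x \<in> X. \<forall>i\<in>J. x i = w i} \<in> sets S"
proof -
  have "(\<lambda>x. x i) -` ({w i} \<inter> \<Lambda>) \<inter> space S \<in> sets S" if "i \<in> J" for i
    using that assms by (intro measurable_sets[OF measurable_coordinate]) auto
  hence "space S - (\<Union>i\<in>J. space S - ((\<lambda>x. x i) -` ({w i} \<inter> \<Lambda>) \<inter> space S)) \<in> sets S"
    by (intro sets.Diff sets.top sets.countable_UN'') auto
  also have "space S - (\<Union>i\<in>J. space S - ((\<lambda>x. x i) -` ({w i} \<inter> \<Lambda>) \<inter> space S)) = {x \<in> X. \<forall>i\<in>J. x i = w i}"
  proof -
    have "w i \<in> \<Lambda>" if "x \<in> X" "i \<in> J" "x i = w i" for x i
      using in_alphabet[of x i] that assms by auto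
    thus ?thesis by auto
  qed
  finally show ?thesis .
qed

lemma invariant_measuresD:
  assumes "\<mu> \<in> invariant_measures I \<Lambda> X"
  shows "prob_space \<mu>" "sets \<mu> = sets S" "space \<mu> = X" "T \<in> measurable \<mu> \<mu>" "distr \<mu> \<mu> T = \<mu>"
    "measurable \<mu> = measurable S"
proof -
  show "prob_space \<mu>" and sets: "sets \<mu> = sets S" and "T \<in> measurable \<mu> \<mu>" and "distr \<mu> \<mu> T = \<mu>"
    using assms by (simp_all add: invariant_measures_def)
  show "space \<mu> = X" using sets_eq_imp_space_eq[OF sets] by simp
  show "measurable \<mu> = measurable S" using measurable_cong_sets[OF sets refl] by (intro ext)
qed

end

locale hoelder_shift = window_shift +
  fixes \<phi> :: "(int \<Rightarrow> nat) \<Rightarrow> real" and C \<theta> :: real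
  assumes C_nonneg: "0 \<le> C" and \<theta>: "0 < \<theta>" "\<theta> < 1"
    and close: "\<And>x y k. x \<in> X \<Longrightarrow> y \<in> X \<Longrightarrow> (\<And>i. i \<in> I \<Longrightarrow> \<bar>i\<bar> < int k \<Longrightarrow> x i = y i)
                  \<Longrightarrow> \<bar>\<phi> x - \<phi> y\<bar> \<le> C * \<theta> ^ k"
begin

definition birkhoff :: "nat \<Rightarrow> (int \<Rightarrow> nat) \<Rightarrow> real" where
  "birkhoff n x = (\<Sum>i<n. \<phi> ((T ^^ i) x))"

lemma birkhoff_add: "birkhoff (m + n) x = birkhoff m x + birkhoff n ((T ^^ m) x)"
proof (induction n)
  case (Suc n)
  thus ?case by (simp add: birkhoff_def funpow_add[of n m] add.commute[of m n])
qed (simp add: birkhoff_def)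

lemma ex_bound: "\<exists>B\<ge>0. \<forall>x\<in>X. \<bar>\<phi> x\<bar> \<le> B"
proof (cases "X = {}")
  case False
  then obtain x0 where x0: "x0 \<in> X" by blast
  have "\<bar>\<phi> x\<bar> \<le> \<bar>\<phi> x0\<bar> + C" if "x \<in> X" for x
    using close[of x x0 0] x0 that by auto
  thus ?thesis using C_nonneg by (intro exI[of _ "\<bar>\<phi> x0\<bar> + C"]) auto
qed (auto intro: exI[of _ 0])

text \<open>
  At time \<open>i\<close> the shifted points agree at all indices closer to \<open>0\<close> than the two ends of the common
  segment, which lie at distance about \<open>i\<close> and \<open>n - i\<close>; the errors form two geometric series.
  This covers one-sided and two-sided sequences alike.
\<close>

lemma birkhoff_distortion:
  assumes "x \<in> X" "y \<in> X" and agree: "seg x 0 n = seg y 0 n"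
  shows "\<bar>birkhoff n x - birkhoff n y\<bar> \<le> 2 * C / (1 - \<theta>)"
proof -
  have summand: "\<bar>\<phi> ((T ^^ i) x) - \<phi> ((T ^^ i) y)\<bar> \<le> C * \<theta> ^ i + C * \<theta> ^ (n - Suc i)" if "i < n" for i
  proof -
    have "\<bar>\<phi> ((T ^^ i) x) - \<phi> ((T ^^ i) y)\<bar> \<le> C * \<theta> ^ min i (n - Suc i)"
    proof (rule close)
      fix a assume a: "a \<in> I" "\<bar>a\<bar> < int (min i (n - Suc i))"
      hence nonneg: "0 \<le> a + int i" and "nat (a + int i) < n" using that by linarith+
      hence "x (0 + int (nat (a + int i))) = y (0 + int (nat (a + int i)))"
        by (intro agree[unfolded seg_eq_iff, rule_format])
      thus "(T ^^ i) x a = (T ^^ i) y a"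
        using a assms nonneg by (simp add: T_power_nth)
    qed (use assms T_power_in_X in auto)
    also have "\<dots> \<le> C * \<theta> ^ i + C * \<theta> ^ (n - Suc i)"
      using C_nonneg \<theta> by (auto simp: min_def)
    finally show ?thesis .
  qed
  have geom: "(\<Sum>i<n. \<theta> ^ i) \<le> 1 / (1 - \<theta>)"
    using \<theta> by (simp add: sum_gp_strict divide_right_mono)
  have "\<bar>birkhoff n x - birkhoff n y\<bar> \<le> (\<Sum>i<n. \<bar>\<phi> ((T ^^ i) x) - \<phi> ((T ^^ i) y)\<bar>)"
    unfolding birkhoff_def sum_subtractf[symmetric] by (rule sum_abs)
  also have "\<dots> \<le> (\<Sum>i<n. C * \<theta> ^ i + C * \<theta> ^ (n - Suc i))"
    using summand by (intro sum_mono) auto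
  also have "\<dots> = 2 * C * (\<Sum>i<n. \<theta> ^ i)"
    using sum.nat_diff_reindex[of "\<lambda>i. \<theta> ^ i" n]
    by (simp add: sum.distrib flip: sum_distrib_left)
  also have "\<dots> \<le> 2 * C * (1 / (1 - \<theta>))"
    using C_nonneg by (intro mult_left_mono geom) auto
  finally show ?thesis by simp
qed

text \<open>
  The potential is the uniform limit of functions of finitely many coordinates, obtained by
  evaluating it at an arbitrary point of \<open>X\<close> with the same coordinates.
\<close>

lemma measurable_potential: "\<phi> \<in> borel_measurable S"
proof (rule borel_measurable_LIMSEQ_real)
  define J where "J k = {i \<in> I. \<bar>i\<bar> < int k}" for k
  define g where "g k u = \<phi> (SOME y. y \<in> X \<and> (\<forall>i\<in>J k. y i = u i))" for k u
  have finJ: "finite (J k)" for k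
    by (rule finite_subset[of _ "{- int k..int k}"]) (auto simp: J_def)
  have JI: "J k \<subseteq> I" for k by (auto simp: J_def)
  have g_close: "\<bar>g k (restrict x (J k)) - \<phi> x\<bar> \<le> C * \<theta> ^ k" if "x \<in> X" for x k
  proof -
    let ?y = "SOME y. y \<in> X \<and> (\<forall>i\<in>J k. y i = restrict x (J k) i)"
    have "?y \<in> X \<and> (\<forall>i\<in>J k. ?y i = restrict x (J k) i)"
      by (rule someI[of _ x]) (use that in auto)
    thus ?thesis unfolding g_def using that by (intro close) (auto simp: J_def)
  qed
  show "(\<lambda>k. g k (restrict x (J k))) \<longlonglongrightarrow> \<phi> x" if "x \<in> space S" for x
  proof (rule LIM_zero_cancel, rule Lim_null_comparison)
    show "\<forall>\<^sub>F k in sequentially. norm (g k (restrict x (J k)) - \<phi> x) \<le> C * \<theta> ^ k"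
      using g_close that by simp
    show "(\<lambda>k. C * \<theta> ^ k) \<longlonglongrightarrow> 0"
      using \<theta> by (intro tendsto_mult_right_zero LIMSEQ_power_zero) simp
  qed
  show "(\<lambda>x. g k (restrict x (J k))) \<in> borel_measurable S" for k
  proof (rule measurable_compose[where f = "\<lambda>x. restrict x (J k)" and N = "count_space (J k \<rightarrow>\<^sub>E \<Lambda>)"])
    have "(\<lambda>x. restrict x (J k)) \<in> space S \<rightarrow> (J k \<rightarrow>\<^sub>E \<Lambda>)"
      using JI[of k] in_alphabet by auto
    moreover have "(\<lambda>x. restrict x (J k)) -` {w} \<inter> space S \<in> sets S" if w: "w \<in> J k \<rightarrow>\<^sub>E \<Lambda>" for w
    proof -
      have "restrict x (J k) = w \<longleftrightarrow> (\<forall>i\<in>J k. x i = w i)" for x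
        using w by (auto intro!: PiE_ext[of _ "J k" "\<lambda>_. UNIV"])
      hence "(\<lambda>x. restrict x (J k)) -` {w} \<inter> space S = {x \<in> X. \<forall>i\<in>J k. x i = w i}" by auto
      thus ?thesis using cylinder_in_sets[OF JI] by simp
    qed
    ultimately show "(\<lambda>x. restrict x (J k)) \<in> measurable S (count_space (J k \<rightarrow>\<^sub>E \<Lambda>))"
      using finJ finite_alphabet by (subst measurable_count_space_eq2) (auto intro: finite_PiE)
  qed simp
qed

lemma integrable_potential:
  assumes "\<mu> \<in> invariant_measures I \<Lambda> X"
  shows "integrable \<mu> (\<lambda>x. \<phi> ((T ^^ i) x))"
proof -
  note inv = invariant_measuresD[OF assms]
  interpret prob_space \<mu> by (rule inv)
  obtain B where B: "\<forall>x\<in>X. \<bar>\<phi> x\<bar> \<le> B" using ex_bound by blast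
  show ?thesis
  proof (rule integrable_const_bound)
    show "AE x in \<mu>. norm (\<phi> ((T ^^ i) x)) \<le> B"
      using B T_power_in_X by (intro AE_I2) (simp add: inv)
    have "\<phi> \<in> borel_measurable \<mu>" using measurable_potential by (simp add: inv)
    with measurable_funpow[OF inv(4)] show "(\<lambda>x. \<phi> ((T ^^ i) x)) \<in> borel_measurable \<mu>"
      by (rule measurable_compose)
  qed
qed

lemma integral_birkhoff:
  assumes "\<mu> \<in> invariant_measures I \<Lambda> X"
  shows "(\<integral>x. birkhoff n x \<partial>\<mu>) = n * (\<integral>x. \<phi> x \<partial>\<mu>)"
proof -
  note inv = invariant_measuresD[OF assms]
  have "\<phi> \<in> borel_measurable \<mu>" using measurable_potential by (simp add: inv)
  hence "(\<integral>x. \<phi> ((T ^^ i) x) \<partial>\<mu>) = (\<integral>x. \<phi> x \<partial>\<mu>)" for i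
    by (rule integral_funpow_invariant[OF inv(4,5)])
  thus ?thesis unfolding birkhoff_def
    by (subst Bochner_Integration.integral_sum) (auto intro: integrable_potential[OF assms])
qed

end

section \<open>Returning points and measures with negative returns\<close>

context window_shift
begin

lemma state_T_power: "x \<in> X \<Longrightarrow> state ((T ^^ j) x) k = state x (k + j)"
  using seg_T_power[OF _ nonneg_in_index, of x "int k" j M] by simp

lemma AE_recurrent:
  assumes "\<mu> \<in> invariant_measures I \<Lambda> X"
  shows "AE x in \<mu>. recurrent x"
proof -
  note inv = invariant_measuresD[OF assms]
  let ?Q = "{u. set u \<subseteq> \<Lambda> \<and> length u = M}"
  interpret prob_space \<mu> by (rule inv)
  define A where "A q = {x \<in> X. \<forall>i\<in>{0..<int M}. x i = q ! nat i}" for q :: "nat list"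
  have A: "A q \<in> sets \<mu>" for q
    unfolding A_def inv(2) by (rule cylinder_in_sets) (auto intro: nonneg_in_index)
  have A_iff: "x \<in> A q \<longleftrightarrow> x \<in> X \<and> state x 0 = q" if "length q = M" for x q
  proof -
    have "(\<forall>i\<in>{0..<int M}. x i = q ! nat i) \<longleftrightarrow> (\<forall>k<M. x (int k) = q ! k)"
      by (metis atLeastLessThan_iff nat_int nat_less_iff of_nat_0_le_iff of_nat_less_iff zero_le_imp_eq_int)
    thus ?thesis using that by (auto simp: A_def list_eq_iff_nth_eq)
  qed
  have "AE x in \<mu>. \<forall>q\<in>?Q. x \<in> A q \<longrightarrow> (\<forall>n. \<exists>k\<ge>n. (T ^^ k) x \<in> A q)"
    using finite_states poincare_recurrence[OF finite_measure_axioms inv(4,5) A]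
    by (intro AE_finite_allI) auto
  thus ?thesis
    using AE_space
  proof eventually_elim
    case (elim x)
    hence x: "x \<in> X" by (simp add: inv)
    have "state x 0 \<in> ?Q"
      using link_imp_states[OF link_point[OF x nonneg_in_index, of 0 0]] by simp
    hence "\<forall>n. \<exists>k\<ge>n. (T ^^ k) x \<in> A (state x 0)"
      using elim(1) x by (auto simp: A_iff)
    thus "recurrent x"
      using state_T_power[OF x, of _ 0] by (auto simp: recurrent_def A_iff)
  qed
qed

text \<open>
  For one-sided sequences this is immediate.  For two-sided ones, let \<open>U k\<close> consist of the points
  that are periodic from index \<open>- k\<close> on.  The shift pulls \<open>U (Suc k)\<close> back to \<open>U k\<close>, so all these
  sets have the same measure, and almost every point of \<open>U 0\<close> lies in all of them.
\<close>

lemma AE_periodic_of_forward_periodic: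
  assumes "\<mu> \<in> invariant_measures I \<Lambda> X"
  shows "AE x in \<mu>. (\<forall>n. x (int (n + l)) = x (int n)) \<longrightarrow> (T ^^ l) x = x"
proof -
  note inv = invariant_measuresD[OF assms]
  interpret prob_space \<mu> by (rule inv)
  have period: "(T ^^ l) x = x" if "x \<in> X" "\<And>i. i \<in> I \<Longrightarrow> x (i + int l) = x i" for x
    using that by (intro X_eqI T_power_in_X) (auto simp: T_power_nth)
  from index show ?thesis
  proof
    assume I: "I = {0..}"
    show ?thesis
    proof (rule AE_I2, rule impI)
      fix x assume "x \<in> space \<mu>" and per: "\<forall>n. x (int (n + l)) = x (int n)"
      have "x (i + int l) = x i" if "i \<in> I" for i
        using per[rule_format, of "nat i"] that by (simp add: I)
      thus "(T ^^ l) x = x" using \<open>x \<in> space \<mu>\<close> by (intro period) (simp_all add: inv)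
    qed
  next
    assume I: "I = UNIV"
    define E where "E i = {x \<in> X. x (i + int l) = x i}" for i
    have E: "E i \<in> sets S" for i
    proof -
      have "E i = (\<Union>a\<in>\<Lambda>. {x \<in> X. \<forall>j\<in>{i, i + int l}. x j = a})"
        using in_alphabet[of _ i] by (auto simp: E_def I)
      also have "\<dots> \<in> sets S"
        using finite_alphabet by (intro sets.finite_UN cylinder_in_sets) (auto simp: I)
      finally show ?thesis .
    qed
    define U where "U k = (\<Inter>i\<in>{- int k..}. E i)" for k
    have U_iff: "x \<in> U k \<longleftrightarrow> x \<in> X \<and> (\<forall>i\<ge>- int k. x (i + int l) = x i)" for x k
      by (auto simp: U_def E_def)
    have U: "U k \<in> sets \<mu>" for k
      unfolding U_def inv(2) using E by (intro sets.countable_INT') auto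
    have "AE x in \<mu>. x \<in> U 0 \<longrightarrow> (\<forall>k. x \<in> U k)"
    proof (rule AE_antimono_equal_measure[OF finite_measure_axioms U])
      fix k
      show "U (Suc k) \<subseteq> U k" by (auto simp: U_iff)
      have "T -` U (Suc k) \<inter> space \<mu> = U k"
      proof (intro set_eqI)
        fix x
        have "(\<forall>i\<ge>- int (Suc k). T x (i + int l) = T x i) \<longleftrightarrow> (\<forall>i\<ge>- int k. x (i + int l) = x i)"
        proof
          assume *: "\<forall>i\<ge>- int (Suc k). T x (i + int l) = T x i"
          show "\<forall>i\<ge>- int k. x (i + int l) = x i"
          proof (intro allI impI)
            fix i assume "i \<ge> - int k"
            thus "x (i + int l) = x i" using *[rule_format, of "i - 1"] by (simp add: shift_def I algebra_simps)
          qed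
        next
          assume *: "\<forall>i\<ge>- int k. x (i + int l) = x i"
          show "\<forall>i\<ge>- int (Suc k). T x (i + int l) = T x i"
          proof (intro allI impI)
            fix i assume "i \<ge> - int (Suc k)"
            thus "T x (i + int l) = T x i" using *[rule_format, of "i + 1"] by (simp add: shift_def I algebra_simps)
          qed
        qed
        thus "x \<in> T -` U (Suc k) \<inter> space \<mu> \<longleftrightarrow> x \<in> U k"
          using T_in_X by (auto simp: U_iff inv)
      qed
      thus "emeasure \<mu> (U (Suc k)) = emeasure \<mu> (U k)"
        using emeasure_vimage_invariant[OF inv(4,5) U] by metis
    qed
    thus ?thesis using AE_space
    proof eventually_elim
      case (elim x)
      show ?case
      proof
        assume per: "\<forall>n. x (int (n + l)) = x (int n)"
        have "x \<in> X" using elim by (simp add: inv)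
        have "x (i + int l) = x i" if "i \<ge> 0" for i
          using per[rule_format, of "nat i"] that by simp
        hence "x \<in> U 0" using \<open>x \<in> X\<close> by (simp add: U_iff)
        hence all: "x \<in> U k" for k using elim by blast
        have "x (i + int l) = x i" for i
          using all[of "nat \<bar>i\<bar>"] by (simp add: U_iff)
        thus "(T ^^ l) x = x" using \<open>x \<in> X\<close> by (intro period)
      qed
    qed
  qed
qed

definition returning :: "(int \<Rightarrow> nat) \<Rightarrow> nat \<Rightarrow> bool" where
  "returning x m \<longleftrightarrow> rich (state x 0) \<and> (\<exists>c. link (state x m) c (state x 0))"

lemma AE_periodic_or_returning:
  "\<exists>l>0. \<forall>\<mu>\<in>invariant_measures I \<Lambda> X. AE x in \<mu>. (T ^^ l) x = x \<or> (\<forall>m. returning x m)"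
proof -
  obtain l where l: "0 < l"
    and period: "\<And>x n. x \<in> X \<Longrightarrow> recurrent x \<Longrightarrow> \<not> rich (state x 0) \<Longrightarrow> x (int (n + l)) = x (int n)"
    using ex_common_period by metis
  have "AE x in \<mu>. (T ^^ l) x = x \<or> (\<forall>m. returning x m)"
    if "\<mu> \<in> invariant_measures I \<Lambda> X" for \<mu>
    using AE_recurrent[OF that] AE_periodic_of_forward_periodic[OF that, of l] AE_space
  proof eventually_elim
    case (elim x)
    hence x: "x \<in> X" using invariant_measuresD(3)[OF that] by simp
    show ?case
    proof (cases "rich (state x 0)")
      case True
      have "\<exists>c. link (state x m) c (state x 0)" for m
      proof -
        obtain k where k: "k \<ge> m" "state x k = state x 0"
          using elim(1) by (auto simp: recurrent_def)
        hence "link (state x m) (seg x (int m) (k - m)) (state x 0)"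
          using link_point[OF x nonneg_in_index, of "int m" "k - m"] by simp
        thus ?thesis by blast
      qed
      thus ?thesis using True by (simp add: returning_def)
    next
      case False
      thus ?thesis using elim period[OF x] by blast
    qed
  qed
  thus ?thesis using l by blast
qed

lemma periodic_points_measurable: "{x \<in> X. (T ^^ l) x = x} \<in> sets S"
proof -
  define E where "E i = {x \<in> X. x (i + int l) = x i}" for i
  have E: "E i \<in> sets S" if "i \<in> I" for i
  proof -
    have "E i = (\<Union>a\<in>\<Lambda>. {x \<in> X. \<forall>j\<in>{i, i + int l}. x j = a})"
      using in_alphabet[of _ i] that by (auto simp: E_def)
    also have "\<dots> \<in> sets S"
      using finite_alphabet that index_add by (intro sets.finite_UN cylinder_in_sets) auto
    finally show ?thesis .
  qed
  have "{x \<in> X. (T ^^ l) x = x} = (\<Inter>i\<in>I. E i)"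
  proof (intro set_eqI iffI)
    fix x assume x: "x \<in> {x \<in> X. (T ^^ l) x = x}"
    have "x (i + int l) = x i" if "i \<in> I" for i
      using T_power_nth[of x i l] x that by simp
    thus "x \<in> (\<Inter>i\<in>I. E i)" using x by (auto simp: E_def)
  next
    fix x assume x: "x \<in> (\<Inter>i\<in>I. E i)"
    hence "x \<in> X" using nonneg_in_index[of 0] by (auto simp: E_def)
    moreover have "(T ^^ l) x = x"
      using x \<open>x \<in> X\<close> by (intro X_eqI T_power_in_X) (auto simp: T_power_nth E_def)
    ultimately show "x \<in> {x \<in> X. (T ^^ l) x = x}" by simp
  qed
  also have "\<dots> \<in> sets S"
    using E nonneg_in_index[of 0] by (intro sets.countable_INT') auto
  finally show ?thesis .
qed

lemma uniform_measure_in_invariant_measures: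
  assumes \<mu>: "\<mu> \<in> invariant_measures I \<Lambda> X" and R: "R \<in> sets S"
    and "AE x in \<mu>. T x \<in> R \<longleftrightarrow> x \<in> R" "measure \<mu> R \<noteq> 0"
  shows "uniform_measure \<mu> R \<in> invariant_measures I \<Lambda> X"
proof -
  note inv = invariant_measuresD[OF \<mu>]
  show ?thesis
    using uniform_measure_invariant[OF inv(1,4,5)] assms
    by (simp add: invariant_measures_def inv(2))
qed

end

context hoelder_shift
begin

text \<open>
  Split an invariant measure along the set \<open>Q\<close> of points of period \<open>l\<close> and its complement \<open>R\<close>.
  The conditional measure \<open>\<nu>\<close> on \<open>R\<close> is invariant and lives on returning points, so
  \<open>\<integral>\<phi> \<le> - 1 / m\<close> for it, and its entropy is at most \<open>E - s * \<integral>\<phi>\<close> by the bound at parameter \<open>s\<close>.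
  Hence \<open>\<nu>\<close> contributes at most \<open>E + (t - s) * \<integral>\<phi> \<le> E - (t - s) / m\<close>, which is nonpositive
  once \<open>t \<ge> s + m * E\<close>; on \<open>Q\<close> there is no entropy and the integral of \<open>\<phi>\<close> is nonpositive.
\<close>

lemma pressure_nonpos_of_negative_returns:
  assumes neg: "\<And>x. x \<in> X \<Longrightarrow> returning x m \<Longrightarrow> birkhoff m x \<le> - 1"
    and int_le_0: "\<And>\<mu>. \<mu> \<in> invariant_measures I \<Lambda> X \<Longrightarrow> (\<integral>x. \<phi> x \<partial>\<mu>) \<le> 0"
    and bound: "\<And>\<mu>. \<mu> \<in> invariant_measures I \<Lambda> X \<Longrightarrow> ks_entropy \<mu> T + ereal (s * (\<integral>x. \<phi> x \<partial>\<mu>)) \<le> ereal E"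
    and "0 \<le> E" "0 \<le> s" and t: "s + real m * E \<le> t"
  shows "pressure I \<Lambda> X (\<lambda>x. t * \<phi> x) \<le> 0"
  unfolding pressure_def
proof (rule SUP_least)
  fix \<mu> assume \<mu>: "\<mu> \<in> invariant_measures I \<Lambda> X"
  note inv = invariant_measuresD[OF \<mu>]
  interpret prob_space \<mu> by (rule inv)
  have meas: "\<phi> \<in> borel_measurable \<mu>" using measurable_potential by (simp add: inv)
  obtain l where l: "0 < l"
    and dich: "\<And>\<nu>. \<nu> \<in> invariant_measures I \<Lambda> X \<Longrightarrow> AE x in \<nu>. (T ^^ l) x = x \<or> (\<forall>m. returning x m)"
    using AE_periodic_or_returning by blast
  define Q where "Q = {x \<in> X. (T ^^ l) x = x}"
  define R where "R = X - Q"
  have Q: "Q \<in> sets \<mu>" unfolding Q_def inv(2) by (rule periodic_points_measurable)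
  have R: "R \<in> sets \<mu>" using Q sets.compl_sets[OF Q] by (simp add: R_def inv(3))
  have "Q \<subseteq> T -` Q \<inter> space \<mu>"
  proof
    fix x assume "x \<in> Q"
    hence "x \<in> X" "(T ^^ l) x = x" by (auto simp: Q_def)
    moreover from this have "(T ^^ l) (T x) = T x" by (simp flip: funpow_swap1)
    ultimately show "x \<in> T -` Q \<inter> space \<mu>" using T_in_X by (simp add: Q_def inv(3))
  qed
  hence "AE x in \<mu>. x \<in> T -` Q \<inter> space \<mu> \<longrightarrow> x \<in> Q"
    using Q measurable_sets[OF inv(4) Q] emeasure_vimage_invariant[OF inv(4,5) Q]
    by (intro AE_of_equal_measure finite_measure_axioms) simp_all
  hence Q_inv: "AE x in \<mu>. T x \<in> Q \<longleftrightarrow> x \<in> Q"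
    using AE_space
  proof eventually_elim
    case (elim x)
    thus ?case using \<open>Q \<subseteq> T -` Q \<inter> space \<mu>\<close> by auto
  qed
  hence R_inv: "AE x in \<mu>. T x \<in> R \<longleftrightarrow> x \<in> R"
    using AE_space
  proof eventually_elim
    case (elim x)
    thus ?case using T_in_X by (auto simp: R_def inv(3))
  qed
  define IQ where "IQ = (\<integral>x. indicator Q x * \<phi> x \<partial>\<mu>)"
  define IR where "IR = (\<integral>x. indicator R x * \<phi> x \<partial>\<mu>)"
  have "integrable \<mu> \<phi>" using integrable_potential[OF \<mu>, of 0] by simp
  hence "(\<integral>x. indicator R x * \<phi> x + indicator Q x * \<phi> x \<partial>\<mu>) = IR + IQ"
    unfolding IR_def IQ_def using Q R
    by (intro Bochner_Integration.integral_add integrable_mult_indicator[where 'b = real, simplified])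
  moreover have "(\<integral>x. indicator R x * \<phi> x + indicator Q x * \<phi> x \<partial>\<mu>) = (\<integral>x. \<phi> x \<partial>\<mu>)"
    by (intro Bochner_Integration.integral_cong) (auto simp: R_def inv(3) split: split_indicator)
  ultimately have split: "(\<integral>x. \<phi> x \<partial>\<mu>) = IR + IQ" by simp
  have IQ: "IQ \<le> 0"
  proof (cases "measure \<mu> Q = 0")
    case True
    hence "Q \<in> null_sets \<mu>" using Q by (simp add: null_sets_def emeasure_eq_measure)
    hence "AE x in \<mu>. x \<notin> Q" by (rule AE_not_in)
    hence "AE x in \<mu>. indicator Q x * \<phi> x = 0" by eventually_elim simp
    hence "IQ = 0" unfolding IQ_def by (rule integral_eq_zero_AE)
    thus ?thesis by simp
  next
    case False
    hence "uniform_measure \<mu> Q \<in> invariant_measures I \<Lambda> X"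
      using uniform_measure_in_invariant_measures[OF \<mu> _ Q_inv] Q by (simp add: inv(2))
    from mult_nonneg_nonpos[OF measure_nonneg int_le_0[OF this]] show ?thesis
      unfolding IQ_def integral_uniform_measure_mult[OF finite_measure_axioms Q meas False, symmetric] .
  qed
  have "0 \<le> real m * E" using assms by simp
  hence "0 \<le> t" "s \<le> t" using assms by linarith+
  have ks: "ks_entropy \<mu> T \<le> ereal (measure \<mu> R) * ks_entropy (uniform_measure \<mu> R) T"
    using ks_entropy_off_periodic[OF inv(1,4) Q _ l] by (simp add: R_def inv(3) Q_def)
  have "ks_entropy \<mu> T + ereal (t * (\<integral>x. \<phi> x \<partial>\<mu>)) \<le> 0"
  proof (cases "measure \<mu> R = 0")
    case True
    hence "ks_entropy \<mu> T \<le> 0" using ks by (simp flip: zero_ereal_def)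
    moreover have "ereal (t * (\<integral>x. \<phi> x \<partial>\<mu>)) \<le> 0"
      using mult_nonneg_nonpos[OF \<open>0 \<le> t\<close> int_le_0[OF \<mu>]] by simp
    ultimately show ?thesis using add_mono by fastforce
  next
    case False
    define a where "a = measure \<mu> R"
    define \<nu> where "\<nu> = uniform_measure \<mu> R"
    define J where "J = (\<integral>x. \<phi> x \<partial>\<nu>)"
    have \<nu>: "\<nu> \<in> invariant_measures I \<Lambda> X"
      unfolding \<nu>_def using uniform_measure_in_invariant_measures[OF \<mu> _ R_inv] R False by (simp add: inv(2))
    note inv' = invariant_measuresD[OF \<nu>]
    interpret N: prob_space \<nu> by (rule inv')
    have "AE x in \<nu>. birkhoff m x \<le> - 1"
      unfolding \<nu>_def
    proof (rule AE_uniform_measureI[OF R])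
      show "AE x in \<mu>. x \<in> R \<longrightarrow> birkhoff m x \<le> - 1"
        using dich[OF \<mu>] by eventually_elim (auto simp: R_def Q_def intro: neg)
    qed
    hence "(\<integral>x. birkhoff m x \<partial>\<nu>) \<le> (\<integral>x. - 1 \<partial>\<nu>)"
      unfolding birkhoff_def
      by (intro integral_mono_AE Bochner_Integration.integrable_sum integrable_potential[OF \<nu>]) auto
    hence J: "real m * J \<le> - 1"
      using integral_birkhoff[OF \<nu>, of m] N.prob_space by (simp add: J_def)
    have J0: "J \<le> 0" unfolding J_def by (rule int_le_0[OF \<nu>])
    have IR: "IR = a * J"
      using integral_uniform_measure_mult[OF finite_measure_axioms R meas False]
      by (simp add: IR_def a_def J_def \<nu>_def)
    have "ks_entropy \<nu> T + ereal (s * J) \<le> ereal E"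
      unfolding J_def by (rule bound[OF \<nu>])
    hence "ks_entropy \<nu> T \<le> ereal (E - s * J)"
      by (cases "ks_entropy \<nu> T") auto
    hence "ereal a * ks_entropy \<nu> T \<le> ereal a * ereal (E - s * J)"
      by (intro ereal_mult_left_mono) (auto simp: a_def)
    hence ks': "ks_entropy \<mu> T \<le> ereal (a * (E - s * J))"
      using ks by (simp add: a_def \<nu>_def)
    have "E + (t - s) * J \<le> 0"
    proof -
      have "(t - s) * J \<le> (real m * E) * J"
        using t J0 by (intro mult_right_mono_neg) auto
      also have "\<dots> = E * (real m * J)" by simp
      also have "\<dots> \<le> E * - 1" using J assms by (intro mult_left_mono) auto
      finally show ?thesis by simp
    qed
    hence "a * (E + (t - s) * J) \<le> 0" by (intro mult_nonneg_nonpos) (simp_all add: a_def)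
    moreover have "t * IQ \<le> 0" using IQ \<open>0 \<le> t\<close> by (intro mult_nonneg_nonpos)
    ultimately have "a * (E - s * J) + t * (\<integral>x. \<phi> x \<partial>\<mu>) \<le> 0"
      unfolding split IR by (simp add: algebra_simps)
    moreover have "ks_entropy \<mu> T + ereal (t * (\<integral>x. \<phi> x \<partial>\<mu>))
        \<le> ereal (a * (E - s * J)) + ereal (t * (\<integral>x. \<phi> x \<partial>\<mu>))"
      by (intro add_mono ks') simp
    ultimately show ?thesis by (simp add: order_trans)
  qed
  thus "ks_entropy \<mu> T + ereal (\<integral>x. t * \<phi> x \<partial>\<mu>) \<le> 0" by simp
qed

end

section \<open>Loops obtained by inserting detours\<close>

lemma seg_eq_appendD:
  assumes "seg y i n = u @ w"
  shows "seg y i (length u) = u" "seg y (i + int (length u)) (length w) = w"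
proof -
  have n: "n = length u + length w" using arg_cong[OF assms, of length] by simp
  have "seg y i (length u) @ seg y (i + int (length u)) (length w) = u @ w"
    using assms by (simp add: seg_append n)
  thus "seg y i (length u) = u" "seg y (i + int (length u)) (length w) = w" by simp_all
qed

context hoelder_shift
begin

lemma birkhoff_ge:
  assumes "x \<in> X" "\<forall>x\<in>X. \<bar>\<phi> x\<bar> \<le> B"
  shows "- (real n * B) \<le> birkhoff n x"
proof -
  have "(\<Sum>i<n. - B) \<le> birkhoff n x"
    unfolding birkhoff_def using assms T_power_in_X by (intro sum_mono) (meson abs_le_D2 minus_le_iff)
  thus ?thesis by simp
qed

text \<open>
  The block \<open>b j\<close> follows a good point \<open>x\<close> up to time \<open>j * l\<close>, makes a detour of length \<open>l\<close>, resumes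
  the path of \<open>x\<close> and closes up.  Of the two loops available at the state of \<open>x\<close> at that time, the
  detour is one that differs from what \<open>x\<close> itself does in the next \<open>l\<close> steps.  So \<open>b j\<close> first departs
  from \<open>x\<close> between times \<open>j * l\<close> and \<open>(j + 1) * l\<close>, which makes the blocks distinct.  The detour
  and the closing word have bounded length, and the rest repeats two segments of \<open>x\<close>.
\<close>

lemma many_loops:
  assumes good: "\<forall>m. \<exists>x\<in>X. returning x m \<and> - 1 \<le> birkhoff m x"
  shows "\<exists>(K::nat) C'. 0 < K \<and> (\<forall>r\<ge>1. \<exists>L v b. 0 < L \<and> L \<le> K * r \<and> inj_on b {..<r} \<and>
           (\<forall>j<r. length (b j) = L \<and> link v (b j) v \<and>
              (\<forall>y\<in>X. seg y 0 L = b j \<longrightarrow> - C' \<le> birkhoff L y)))"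
proof -
  obtain l where l: "0 < l" and loops:
      "\<And>q. rich q \<Longrightarrow> \<exists>d d'. link q d q \<and> link q d' q \<and> length d = l \<and> length d' = l \<and> d \<noteq> d'"
    using ex_common_loop_length by blast
  obtain G where G: "\<And>q c q'. link q c q' \<Longrightarrow> \<exists>c. link q c q' \<and> length c \<le> G"
    using ex_connector_bound by blast
  obtain B where B: "0 \<le> B" "\<forall>x\<in>X. \<bar>\<phi> x\<bar> \<le> B" using ex_bound by blast
  define D where "D = 2 * C / (1 - \<theta>)"
  define C' where "C' = 1 + 2 * D + real (l + G) * B"
  have "\<exists>L v b. 0 < L \<and> L \<le> (2 * l + G) * r \<and> inj_on b {..<r} \<and>
           (\<forall>j<r. length (b j) = L \<and> link v (b j) v \<and>
              (\<forall>y\<in>X. seg y 0 L = b j \<longrightarrow> - C' \<le> birkhoff L y))" if r: "1 \<le> r" for r :: nat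
  proof -
    define m where "m = r * l"
    obtain x where x: "x \<in> X" "returning x m" "- 1 \<le> birkhoff m x" using good by blast
    obtain c where c: "link (state x m) c (state x 0)" "length c \<le> G"
      using x(2) G unfolding returning_def by blast
    have walk: "link (state x p) (seg x (int p) (n - p)) (state x n)" if "p \<le> n" for p n
      using link_point[OF x(1) nonneg_in_index, of "int p" "n - p"] that by simp
    have "\<exists>d. link (state x p) d (state x p) \<and> length d = l \<and> d \<noteq> seg x (int p) l" if "p \<le> m" for p
    proof -
      have "rich (state x p)"
        using rich_transfer[OF link_trans[OF walk[OF that] c(1)] walk[OF le0]] x(2)
        by (simp add: returning_def)
      thus ?thesis using loops by metis
    qed
    then obtain d where d: "\<And>p. p \<le> m \<Longrightarrow> link (state x p) (d p) (state x p)"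
        "\<And>p. p \<le> m \<Longrightarrow> length (d p) = l" "\<And>p. p \<le> m \<Longrightarrow> d p \<noteq> seg x (int p) l"
      by metis
    \<comment> \<open>The detour is inserted at a multiple of \<open>l\<close>, so that the times of departure from \<open>x\<close> fall into
      disjoint intervals.\<close>
    define b where "b j = seg x 0 (j * l) @ d (j * l) @ seg x (int (j * l)) (m - j * l) @ c" for j
    define L where "L = m + l + length c"
    have jl: "j * l \<le> m" "j * l + l \<le> m" if "j < r" for j
    proof -
      have "Suc j * l \<le> r * l" using that by (intro mult_right_mono) auto
      thus "j * l \<le> m" "j * l + l \<le> m" unfolding m_def mult_Suc by linarith+
    qed
    have "0 < L" using l by (simp add: L_def)
    moreover have "L \<le> (2 * l + G) * r"
    proof -
      have "l \<le> l * r" using r by simp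
      moreover have "length c \<le> G * r" using mult_le_mono[OF c(2) r] by simp
      moreover have "(2 * l + G) * r = r * l + l * r + G * r" by (simp add: algebra_simps)
      ultimately show ?thesis unfolding L_def m_def by linarith
    qed
    moreover have "inj_on b {..<r}"
    proof -
      have "b i \<noteq> b j" if "i < j" "j < r" for i j
      proof
        assume eq: "b i = b j"
        have "Suc i * l \<le> j * l" using that by (intro mult_right_mono) auto
        hence le: "i * l + l \<le> j * l" by simp
        have "take (i * l + l) (b i) = seg x 0 (i * l) @ d (i * l)"
          using d(2)[of "i * l"] jl[of i] that by (simp add: b_def)
        moreover have "take (i * l + l) (b j) = seg x 0 (i * l + l)"
          using le by (simp add: b_def take_seg)
        moreover have "seg x 0 (i * l + l) = seg x 0 (i * l) @ seg x (int (i * l)) l"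
          by (simp flip: seg_append)
        ultimately have "d (i * l) = seg x (int (i * l)) l" using eq by simp
        thus False using d(3)[of "i * l"] jl[of i] that by simp
      qed
      thus ?thesis unfolding inj_on_def by (metis lessThan_iff linorder_neqE_nat)
    qed
    moreover have "length (b j) = L" if "j < r" for j
      using jl[OF that] d(2) by (simp add: b_def L_def)
    moreover have "link (state x 0) (b j) (state x 0)" if "j < r" for j
    proof -
      have "link (state x 0) (seg x 0 (j * l)) (state x (j * l))"
        using walk[of 0 "j * l"] by simp
      thus ?thesis
        unfolding b_def using d(1) walk[OF jl(1)[OF that]] c(1) jl[OF that] by (blast intro: link_trans)
    qed
    moreover have "- C' \<le> birkhoff L y" if "j < r" "y \<in> X" "seg y 0 L = b j" for j y
    proof -
      define p where "p = j * l"
      have p: "p \<le> m" and len: "length (d p) = l" using jl[OF that(1)] d(2) by (auto simp: p_def)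
      have y: "seg y 0 L = seg x 0 p @ d p @ seg x (int p) (m - p) @ c"
        using that(3) by (simp add: b_def p_def)
      have y1: "seg y 0 p = seg x 0 p" using seg_eq_appendD(1)[OF y] by simp
      have "seg y (int p + int l) (m - p) = seg x (int p) (m - p)"
        using seg_eq_appendD(1)[OF seg_eq_appendD(2)[OF seg_eq_appendD(2)[OF y]]] len by simp
      hence y2: "seg ((T ^^ (p + l)) y) 0 (m - p) = seg ((T ^^ p) x) 0 (m - p)"
        using seg_T_power[OF that(2) nonneg_in_index, of 0 "p + l"] seg_T_power[OF x(1) nonneg_in_index, of 0 p]
        by simp
      note inX = T_power_in_X[OF that(2)] T_power_in_X[OF x(1)]
      have L: "L = ((p + l) + (m - p)) + length c" using p by (simp add: L_def)
      have "birkhoff L y = birkhoff p y + birkhoff l ((T ^^ p) y)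
          + birkhoff (m - p) ((T ^^ (p + l)) y) + birkhoff (length c) ((T ^^ (p + l + (m - p))) y)"
        unfolding L birkhoff_add by simp
      moreover have "birkhoff m x = birkhoff p x + birkhoff (m - p) ((T ^^ p) x)"
        using birkhoff_add[of p "m - p" x] p by simp
      moreover have "\<bar>birkhoff p y - birkhoff p x\<bar> \<le> D"
        unfolding D_def by (rule birkhoff_distortion[OF that(2) x(1) y1])
      moreover have "\<bar>birkhoff (m - p) ((T ^^ (p + l)) y) - birkhoff (m - p) ((T ^^ p) x)\<bar> \<le> D"
        unfolding D_def by (rule birkhoff_distortion[OF inX y2])
      moreover have "- (real l * B) \<le> birkhoff l ((T ^^ p) y)" by (rule birkhoff_ge[OF inX(1) B(2)])
      moreover have "- (real (length c) * B) \<le> birkhoff (length c) ((T ^^ (p + l + (m - p))) y)"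
        by (rule birkhoff_ge[OF inX(1) B(2)])
      moreover have "real (length c) * B \<le> real G * B" using c B by (intro mult_right_mono) auto
      moreover have "C' = 1 + 2 * D + (real l * B + real G * B)" by (simp add: C'_def algebra_simps)
      ultimately show ?thesis using x(3) unfolding abs_le_iff by linarith
    qed
    ultimately show ?thesis by blast
  qed
  thus ?thesis using l by (intro exI[of _ "2 * l + G"] exI[of _ C']) auto
qed

end

section \<open>The Bernoulli measure on concatenations of loops\<close>

text \<open>
  \<open>N\<close> different loops of one length \<open>L\<close> at a state \<open>v\<close>, which may be concatenated freely.
\<close>

locale horseshoe = window_shift +
  fixes b :: "nat \<Rightarrow> nat list" and N L :: nat and v :: "nat list"
  assumes N_pos: "0 < N" and L_pos: "0 < L" and inj_b: "inj_on b {..<N}"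
    and length_b: "\<And>j. j < N \<Longrightarrow> length (b j) = L"
    and link_b: "\<And>j. j < N \<Longrightarrow> link v (b j) v"
begin

text \<open>
  Bi-infinite sequences of independent uniformly distributed block numbers, used for one-sided
  shifts as well.
\<close>

definition \<Omega> :: "(int \<Rightarrow> nat) measure" where
  "\<Omega> = PiM UNIV (\<lambda>_. uniform_count_measure {..<N})"

definition chain :: "(int \<Rightarrow> nat) \<Rightarrow> int \<Rightarrow> nat" where
  "chain \<xi> i = b (\<xi> (i div int L)) ! nat (i mod int L)"

text \<open>
  The point read off the concatenated blocks starting at position \<open>j\<close>; the law of \<open>point 0\<close> is
  invariant under the \<open>L\<close>-th power of the shift only.
\<close>

definition point :: "nat \<Rightarrow> (int \<Rightarrow> nat) \<Rightarrow> int \<Rightarrow> nat" where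
  "point j \<xi> = (\<lambda>i\<in>I. chain \<xi> (i + int j))"

text \<open>
  Averaging over a uniformly chosen starting position in a block makes the law shift invariant.
\<close>

definition \<mu> :: "(int \<Rightarrow> nat) measure" where
  "\<mu> = measure_pmf (pmf_of_set {..<L}) \<bind> (\<lambda>j. distr \<Omega> S (point j))"

lemma space_\<Omega>: "space \<Omega> = UNIV \<rightarrow>\<^sub>E {..<N}"
  by (simp add: \<Omega>_def space_PiM space_uniform_count_measure)

lemma coordinate_less: "\<xi> \<in> space \<Omega> \<Longrightarrow> \<xi> a < N"
  by (auto simp: space_\<Omega>)

lemma prob_space_\<Omega>: "prob_space \<Omega>"
  unfolding \<Omega>_def using N_pos by (intro prob_space_PiM prob_space_uniform_count_measure) auto

lemma seg_chain_block:
  assumes "\<xi> \<in> space \<Omega>"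
  shows "seg (chain \<xi>) (a * int L) L = b (\<xi> a)"
  using L_pos length_b[OF coordinate_less[OF assms]]
  by (intro nth_equalityI) (simp_all add: chain_def)

lemma link_chain:
  assumes "\<xi> \<in> space \<Omega>"
  shows "link v (seg (chain \<xi>) (a * int L) (Suc n * L)) v"
proof (induction n arbitrary: a)
  case 0
  thus ?case
    using link_b[OF coordinate_less[OF assms]] by (simp add: seg_chain_block[OF assms])
next
  case (Suc n)
  have "seg (chain \<xi>) (a * int L) (Suc (Suc n) * L)
      = seg (chain \<xi>) (a * int L) L @ seg (chain \<xi>) ((a + 1) * int L) (Suc n * L)"
    using seg_append[of "chain \<xi>" "a * int L" L "Suc n * L"] by (simp add: algebra_simps)
  thus ?case
    using link_trans[OF link_b[OF coordinate_less[OF assms]] Suc]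
    by (simp add: seg_chain_block[OF assms])
qed

lemma point_in_X:
  assumes "\<xi> \<in> space \<Omega>"
  shows "point j \<xi> \<in> X"
proof -
  have window: "set (seg (chain \<xi>) i (Suc M)) \<subseteq> \<Lambda> \<and> ok (seg (chain \<xi>) i M)" for i
  proof -
    define a k where "a = i div int L" and "k = nat (i mod int L)"
    have i: "i = a * int L + int k" and k: "k < L"
      using L_pos by (simp_all add: a_def k_def nat_less_iff)
    \<comment> \<open>Each block has length at least \<open>1\<close>, so the window ends before \<open>M + 2\<close> blocks have passed.\<close>
    have "Suc M + k \<le> Suc (Suc M) * L" 
    proof -
      have "Suc M * 1 \<le> Suc M * L" using L_pos by (intro mult_le_mono) auto
      thus ?thesis using k by simp
    qed
    hence len: "k + Suc M \<le> Suc (Suc M) * L" by simp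
    define w where "w = seg (chain \<xi>) (a * int L) (Suc (Suc M) * L)"
    have legal: "legal (w @ v)"
      using link_chain[OF assms, of a "Suc M"] by (simp add: link_def w_def)
    have sub: "seg (chain \<xi>) i n = take n (drop k (w @ v))" if "n \<le> Suc M" for n
    proof -
      have "take n (drop k (w @ v)) = take n (drop k w)"
        using len that by (simp add: w_def)
      also have "\<dots> = seg (chain \<xi>) i n"
        using len that by (simp add: w_def drop_seg take_seg i)
      finally show ?thesis by simp
    qed
    have "set (seg (chain \<xi>) i (Suc M)) \<subseteq> set (w @ v)"
      using sub[of "Suc M"] set_take_subset[of "Suc M" "drop k (w @ v)"] set_drop_subset[of k "w @ v"]
      by (metis order_refl order_trans)
    hence "set (seg (chain \<xi>) i (Suc M)) \<subseteq> \<Lambda>" using legal by (auto simp: legal_def)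
    moreover have "k + M \<le> length (w @ v)" using len by (simp add: w_def)
    hence "ok (take M (drop k (w @ v)))" using legal by (simp add: legal_def)
    hence "ok (seg (chain \<xi>) i M)" using sub[of M] by simp
    ultimately show ?thesis by simp
  qed
  have "chain \<xi> i \<in> \<Lambda>" for i
  proof -
    have "chain \<xi> i = seg (chain \<xi>) i (Suc M) ! 0" by simp
    also have "\<dots> \<in> set (seg (chain \<xi>) i (Suc M))" by (intro nth_mem) simp
    finally show ?thesis using window by blast
  qed
  moreover have "seg (point j \<xi>) i M = seg (chain \<xi>) (i + int j) M" if "i \<in> I" for i
    unfolding seg_eq_iff using index_add[OF that] by (simp add: point_def algebra_simps)
  ultimately show ?thesis using window by (simp add: X_eq point_def)
qed

lemma T_point: "T (point j \<xi>) = point (Suc j) \<xi>"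
  using index_add[of _ 1] by (auto simp: shift_def point_def algebra_simps)

lemma T_power_point: "(T ^^ j) (point 0 \<xi>) = point j \<xi>"
  by (induction j) (simp_all add: T_point)

lemma point_L: "point L \<xi> = point 0 (\<lambda>a. \<xi> (a + 1))"
  using L_pos by (auto simp: point_def chain_def)

lemma measurable_coordinate_\<Omega>: "(\<lambda>\<xi>. \<xi> a) \<in> measurable \<Omega> (uniform_count_measure {..<N})"
  unfolding \<Omega>_def by (rule measurable_component_singleton) simp

lemma measurable_point: "point j \<in> measurable \<Omega> S"
proof (rule measurable_into_S)
  fix i assume i: "i \<in> I"
  define a k where "a = (i + int j) div int L" and "k = nat ((i + int j) mod int L)"
  have "(\<lambda>n. b n ! k) \<in> measurable (uniform_count_measure {..<N}) (count_space \<Lambda>)"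
  proof -
    have "b n ! k \<in> \<Lambda>" if "n < N" for n
    proof -
      have "k < length (b n)" using L_pos length_b[OF that] by (simp add: k_def nat_less_iff)
      hence "b n ! k \<in> set (b n)" by (rule nth_mem)
      thus ?thesis using link_b[OF that] by (auto simp: link_def legal_def)
    qed
    thus ?thesis
      by (auto simp: measurable_def space_uniform_count_measure sets_uniform_count_measure)
  qed
  from measurable_compose[OF measurable_coordinate_\<Omega> this, of a]
  show "(\<lambda>\<xi>. point j \<xi> i) \<in> measurable \<Omega> (count_space \<Lambda>)"
    using i by (simp add: point_def chain_def a_def k_def)
qed (rule point_in_X)

lemma distr_shift_\<Omega>: "distr \<Omega> \<Omega> (\<lambda>\<xi> a. \<xi> (a + 1)) = \<Omega>"
  using distr_PiM_reindex[of UNIV "\<lambda>_. uniform_count_measure {..<N}" "\<lambda>a::int. a + 1" UNIV] N_pos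
  unfolding \<Omega>_def by (simp add: prob_space_uniform_count_measure lessThan_empty_iff restrict_UNIV)

lemma measurable_shift_\<Omega>: "(\<lambda>\<xi> a. \<xi> (a + 1)) \<in> measurable \<Omega> \<Omega>"
proof -
  have "(\<lambda>\<xi>. \<lambda>a\<in>UNIV. \<xi> (a + 1)) \<in> measurable \<Omega> (PiM UNIV (\<lambda>_. uniform_count_measure {..<N}))"
    by (intro measurable_restrict measurable_coordinate_\<Omega>)
  thus ?thesis by (simp add: \<Omega>_def restrict_UNIV)
qed

lemma distr_point_Suc: "distr (distr \<Omega> S (point j)) S T = distr \<Omega> S (point (Suc j))"
  by (subst distr_distr[OF measurable_T measurable_point]) (simp add: comp_def T_point)

lemma distr_point_L: "distr \<Omega> S (point L) = distr \<Omega> S (point 0)"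
proof -
  have "distr \<Omega> S (point L) = distr \<Omega> S (point 0 \<circ> (\<lambda>\<xi> a. \<xi> (a + 1)))"
    by (intro arg_cong[of _ _ "distr \<Omega> S"]) (auto simp: point_L)
  also have "\<dots> = distr (distr \<Omega> \<Omega> (\<lambda>\<xi> a. \<xi> (a + 1))) S (point 0)"
    by (rule distr_distr[OF measurable_point measurable_shift_\<Omega>, symmetric])
  finally show ?thesis by (simp add: distr_shift_\<Omega>)
qed

lemma prob_space_distr_point: "prob_space (distr \<Omega> S (point j))"
  using prob_space.prob_space_distr[OF prob_space_\<Omega> measurable_point] .

lemma kernel: "(\<lambda>j. distr \<Omega> S (point j)) \<in> measurable (measure_pmf (pmf_of_set {..<L})) (subprob_algebra S)"
  using prob_space_distr_point
  by (auto simp: space_subprob_algebra prob_space_imp_subprob_space)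

lemma sets_\<mu>: "sets \<mu> = sets S"
  unfolding \<mu>_def by (rule sets_bind) simp_all

lemma emeasure_\<mu>:
  assumes "A \<in> sets S"
  shows "emeasure \<mu> A = (\<Sum>j<L. emeasure (distr \<Omega> S (point j)) A) / of_nat L"
  unfolding \<mu>_def using L_pos
  by (subst emeasure_bind[OF _ kernel assms]) (simp_all add: nn_integral_pmf_of_set lessThan_empty_iff)

lemma \<mu>_invariant: "\<mu> \<in> invariant_measures I \<Lambda> X"
proof -
  have space: "space \<mu> = X" using sets_eq_imp_space_eq[OF sets_\<mu>] by simp
  have X: "X \<in> sets S" using sets.top[of S] by simp
  have T: "T \<in> measurable \<mu> \<mu>"
    using measurable_T by (simp add: measurable_cong_sets[OF sets_\<mu> sets_\<mu>])
  have "emeasure (distr \<Omega> S (point j)) X = 1" for j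
    using prob_space.emeasure_space_1[OF prob_space_distr_point[of j]] by simp
  hence "emeasure \<mu> X = 1"
    using L_pos by (simp add: emeasure_\<mu>[OF X] ennreal_divide_self of_nat_less_top)
  hence "prob_space \<mu>" by (intro prob_spaceI) (simp add: space)
  moreover have "distr \<mu> \<mu> T = \<mu>"
  proof (rule measure_eqI)
    fix A assume "A \<in> sets (distr \<mu> \<mu> T)"
    hence A: "A \<in> sets S" by (simp add: sets_\<mu>)
    have TA: "T -` A \<inter> space S \<in> sets S" by (rule measurable_sets[OF measurable_T A])
    have step: "emeasure (distr \<Omega> S (point j)) (T -` A \<inter> space S) = emeasure (distr \<Omega> S (point (Suc j))) A" for j
      unfolding distr_point_Suc[symmetric] using measurable_T A
      by (subst emeasure_distr[of T "distr \<Omega> S (point j)"]) simp_all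
    have "emeasure (distr \<mu> \<mu> T) A = emeasure \<mu> (T -` A \<inter> space S)"
      using T A by (simp add: emeasure_distr sets_\<mu> space)
    also have "\<dots> = (\<Sum>j<L. emeasure (distr \<Omega> S (point (Suc j))) A) / of_nat L"
      unfolding emeasure_\<mu>[OF TA] step ..
    also have "(\<Sum>j<L. emeasure (distr \<Omega> S (point (Suc j))) A) = (\<Sum>j<L. emeasure (distr \<Omega> S (point j)) A)"
    proof -
      let ?e = "\<lambda>j. emeasure (distr \<Omega> S (point j)) A"
      obtain L' where L': "L = Suc L'" using L_pos by (cases L) auto
      have "(\<Sum>j<L. ?e (Suc j)) = (\<Sum>j<L'. ?e (Suc j)) + ?e 0"
        using distr_point_L by (simp add: L')
      also have "\<dots> = (\<Sum>j<L. ?e j)"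
        by (simp add: L' sum.lessThan_Suc_shift add.commute del: sum.lessThan_Suc)
      finally show ?thesis .
    qed
    finally show "emeasure (distr \<mu> \<mu> T) A = emeasure \<mu> A"
      by (simp add: emeasure_\<mu>[OF A])
  qed simp
  ultimately show ?thesis using T by (simp add: invariant_measures_def sets_\<mu>)
qed

lemma integral_\<mu>:
  fixes f :: "(int \<Rightarrow> nat) \<Rightarrow> real"
  assumes f: "f \<in> borel_measurable S" and B: "\<And>x. x \<in> X \<Longrightarrow> \<bar>f x\<bar> \<le> B"
  shows "(\<integral>x. f x \<partial>\<mu>) = (\<Sum>j<L. \<integral>\<xi>. f (point j \<xi>) \<partial>\<Omega>) / real L"
proof -
  have "(\<integral>x. f x \<partial>\<mu>) = (\<integral>j. (\<integral>x. f x \<partial>distr \<Omega> S (point j)) \<partial>measure_pmf (pmf_of_set {..<L}))"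
    unfolding \<mu>_def
  proof (rule integral_bind[OF f _ kernel])
    show "AE j in measure_pmf (pmf_of_set {..<L}).
        emeasure (distr \<Omega> S (point j)) (space (distr \<Omega> S (point j))) \<le> ennreal 1"
      using prob_space.emeasure_space_1[OF prob_space_distr_point] by (intro AE_I2) simp
  qed (use B in \<open>auto simp: measure_pmf.finite_measure_axioms\<close>)
  also have "\<dots> = (\<Sum>j<L. \<integral>x. f x \<partial>distr \<Omega> S (point j)) / real L"
    using L_pos by (simp add: integral_pmf_of_set lessThan_empty_iff)
  also have "(\<lambda>j. \<integral>x. f x \<partial>distr \<Omega> S (point j)) = (\<lambda>j. \<integral>\<xi>. f (point j \<xi>) \<partial>\<Omega>)"
    by (intro ext integral_distr measurable_point f)
  finally show ?thesis .
qed

text \<open>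
  A window of length at least \<open>Suc k * L\<close> contains \<open>k\<close> complete blocks, those numbered
  \<open>1\<close> to \<open>k\<close>, whatever the starting position \<open>j < L\<close> is.  As the blocks are distinct words, these
  \<open>k\<close> independent block numbers are determined by the window.
\<close>

lemma measure_distr_point_cylinder:
  assumes A: "A \<in> sets S" and agree: "\<And>x y n'. x \<in> A \<Longrightarrow> y \<in> A \<Longrightarrow> n' < n \<Longrightarrow> x (int n') = y (int n')"
    and k: "Suc k * L \<le> n" and j: "j < L"
  shows "emeasure (distr \<Omega> S (point j)) A \<le> ennreal ((1 / real N) ^ k)"
proof (cases "point j -` A \<inter> space \<Omega> = {}")
  case True
  thus ?thesis using A by (simp add: emeasure_distr[OF measurable_point])
next
  case False
  then obtain \<xi>0 where \<xi>0: "\<xi>0 \<in> space \<Omega>" "point j \<xi>0 \<in> A" by auto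
  let ?U = "\<lambda>_::int. uniform_count_measure {..<N}"
  let ?J = "{1..int k}"
  define Z where "Z = prod_emb UNIV ?U ?J (Pi\<^sub>E ?J (\<lambda>a. {\<xi>0 a}))"
  have "point j -` A \<inter> space \<Omega> \<subseteq> Z"
  proof
    fix \<xi> assume "\<xi> \<in> point j -` A \<inter> space \<Omega>"
    hence \<xi>: "\<xi> \<in> space \<Omega>" "point j \<xi> \<in> A" by auto
    have "\<xi> a = \<xi>0 a" if a: "a \<in> ?J" for a
    proof -
      have "chain \<xi> (a * int L + int i) = chain \<xi>0 (a * int L + int i)" if i: "i < L" for i
      proof -
        define n' where "n' = nat (a * int L + int i - int j)"
        have "1 * int L \<le> a * int L" "a * int L \<le> int k * int L"
          using a by (intro mult_right_mono; simp)+
        moreover have "int k * int L + int L \<le> int n" using k by (simp flip: of_nat_mult of_nat_add)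
        ultimately have n': "int n' = a * int L + int i - int j" and "n' < n"
          using i j unfolding n'_def by linarith+
        have "point j \<xi> (int n') = point j \<xi>0 (int n')"
          using \<xi>(2) \<xi>0(2) \<open>n' < n\<close> by (rule agree)
        moreover have "point j \<zeta> (int n') = chain \<zeta> (int n' + int j)" for \<zeta>
          using nonneg_in_index[of "int n'"] by (simp add: point_def)
        moreover have "int n' + int j = a * int L + int i" using n' by simp
        ultimately show ?thesis by simp
      qed
      hence "seg (chain \<xi>) (a * int L) L = seg (chain \<xi>0) (a * int L) L"
        by (simp add: seg_eq_iff)
      hence "b (\<xi> a) = b (\<xi>0 a)" by (simp add: seg_chain_block \<xi> \<xi>0)
      thus ?thesis
        using inj_b coordinate_less[OF \<xi>(1)] coordinate_less[OF \<xi>0(1)] by (auto dest: inj_onD)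
    qed
    thus "\<xi> \<in> Z"
      using \<xi>(1) by (auto simp: Z_def prod_emb_def space_\<Omega> space_uniform_count_measure PiE_def)
  qed
  moreover have "Z \<in> sets \<Omega>"
    unfolding Z_def \<Omega>_def using coordinate_less[OF \<xi>0(1)]
    by (intro sets_PiM_I) (auto simp: sets_uniform_count_measure)
  ultimately have "emeasure \<Omega> (point j -` A \<inter> space \<Omega>) \<le> emeasure \<Omega> Z"
    by (rule emeasure_mono)
  also have "\<dots> = (\<Prod>a\<in>?J. emeasure (?U a) {\<xi>0 a})"
    unfolding Z_def \<Omega>_def using coordinate_less[OF \<xi>0(1)] N_pos
    by (intro emeasure_PiM_emb prob_space_uniform_count_measure)
      (auto simp: sets_uniform_count_measure lessThan_empty_iff)
  also have "\<dots> = (\<Prod>a\<in>?J. ennreal (1 / real N))"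
    using coordinate_less[OF \<xi>0(1)] by (intro prod.cong) (auto simp: emeasure_uniform_count_measure)
  also have "\<dots> = ennreal ((1 / real N) ^ k)"
    by (simp add: ennreal_power)
  finally show ?thesis using A by (simp add: emeasure_distr[OF measurable_point])
qed

lemma measure_\<mu>_cylinder:
  assumes A: "A \<in> sets S" and agree: "\<And>x y n'. x \<in> A \<Longrightarrow> y \<in> A \<Longrightarrow> n' < n \<Longrightarrow> x (int n') = y (int n')"
    and k: "Suc k * L \<le> n"
  shows "measure \<mu> A \<le> (1 / real N) ^ k"
proof -
  have "emeasure \<mu> A \<le> (\<Sum>j<L. ennreal ((1 / real N) ^ k)) / of_nat L"
    unfolding emeasure_\<mu>[OF A]
  proof (intro divide_right_mono_ennreal sum_mono)
    fix j assume "j \<in> {..<L}"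
    show "emeasure (distr \<Omega> S (point j)) A \<le> ennreal ((1 / real N) ^ k)"
      by (rule measure_distr_point_cylinder[where n = n]) (use A agree k \<open>j \<in> {..<L}\<close> in auto)
  qed
  also have "\<dots> = ennreal ((1 / real N) ^ k)"
    using L_pos by (simp add: mult.commute[of "of_nat L"] ennreal_mult_divide_eq)
  finally show ?thesis
    unfolding measure_def by (intro enn2real_leI) simp_all
qed

text \<open>
  Atoms of the partition into \<open>n\<close>-cylinders have measure at most \<open>(1 / N) ^ (n div L - 1)\<close>.
\<close>

lemma entropy_\<mu>: "ereal (ln (real N) / real L) \<le> ks_entropy \<mu> T"
proof -
  note inv = invariant_measuresD[OF \<mu>_invariant]
  define P where "P = (\<lambda>a. {x \<in> X. x 0 = a}) ` \<Lambda> - {{}}"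
  have P: "finite P" "P \<subseteq> sets \<mu>" "partition_on (space \<mu>) P"
  proof -
    show "finite P" unfolding P_def using finite_alphabet by blast
    have "{x \<in> X. x 0 = a} \<in> sets \<mu>" for a
      using cylinder_in_sets[of "{0}" "\<lambda>_. a"] nonneg_in_index[of 0] by (simp add: inv(2))
    thus "P \<subseteq> sets \<mu>" by (auto simp: P_def)
    show "partition_on (space \<mu>) P"
      using in_alphabet[OF _ nonneg_in_index, of _ 0]
      by (auto simp: P_def partition_on_def inv(3) disjoint_def)
  qed
  define h where "h n = real (n div L - 1) * ln (real N) / real n" for n
  have bound: "h n \<le> partition_entropy \<mu> (refined_partition \<mu> T P n) / real n" if n: "L \<le> n" for n
  proof -
    define k where "k = n div L - 1"
    have k: "Suc k * L \<le> n"
    proof -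
      have "0 < n div L" using n L_pos by (simp add: div_greater_zero_iff)
      hence "Suc k = n div L" by (simp add: k_def)
      thus ?thesis by simp
    qed
    note R = refined_partition_props[OF inv(4) P, of n]
    have "- ln ((1 / real N) ^ k) \<le> partition_entropy \<mu> (refined_partition \<mu> T P n)"
    proof (rule entropy_ge_of_small_atoms[OF inv(1) R])
      fix A assume A: "A \<in> refined_partition \<mu> T P n"
      then obtain B where B: "B \<in> {..<n} \<rightarrow>\<^sub>E P" "A = {x \<in> X. \<forall>i<n. (T ^^ i) x \<in> B i}"
        by (auto simp: refined_partition_def inv(3))
      show "measure \<mu> A \<le> (1 / real N) ^ k"
      proof (rule measure_\<mu>_cylinder[OF _ _ k])
        show "A \<in> sets S" using A R(2) by (auto simp: inv(2))
        fix x y i assume xy: "x \<in> A" "y \<in> A" "i < n"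
        hence "B i \<in> P" using B(1) by auto
        then obtain a where a: "B i = {x \<in> X. x 0 = a}" by (auto simp: P_def)
        have "z (int i) = a" if "z \<in> A" for z
        proof -
          have "z \<in> X" "(T ^^ i) z \<in> B i" using that xy(3) by (auto simp: B(2))
          thus ?thesis using T_power_nth[of z 0 i] nonneg_in_index[of 0] by (simp add: a)
        qed
        from this[OF xy(1)] this[OF xy(2)] show "x (int i) = y (int i)" by simp
      qed
    qed (use N_pos in simp)
    moreover have "- ln ((1 / real N) ^ k) = real k * ln (real N)"
      using N_pos by (simp add: ln_realpow ln_div)
    ultimately show ?thesis by (simp add: h_def k_def divide_right_mono)
  qed
  have "(\<lambda>n. ereal (h n)) \<longlonglongrightarrow> ereal (ln (real N) / real L)"
  proof -
    have "h \<longlonglongrightarrow> ln (real N) / real L"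
    proof (rule tendsto_sandwich)
      \<comment> \<open>\<open>n div L - 1\<close> lies between \<open>n / L - 2\<close> and \<open>n / L\<close>.\<close>
      define c where "c = ln (real N)"
      have c: "0 \<le> c" using N_pos by (simp add: c_def)
      show "(\<lambda>n. c / real L - 2 * c / real n) \<longlonglongrightarrow> ln (real N) / real L"
        using tendsto_diff[OF tendsto_const lim_const_over_n, of "c / real L" "2 * c"] by (simp add: c_def)
      show "(\<lambda>n. c / real L) \<longlonglongrightarrow> ln (real N) / real L" by (simp add: c_def)
      have div: "real n / real L - 2 \<le> real (n div L - 1)" "real (n div L - 1) \<le> real n / real L" for n
      proof -
        have "real n = real (n div L) * real L + real (n mod L)"
          by (simp flip: of_nat_mult of_nat_add)
        hence "real n / real L = (real (n div L) * real L + real (n mod L)) / real L" by simp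
        also have "\<dots> = real (n div L) + real (n mod L) / real L"
          using L_pos by (simp add: add_divide_distrib)
        finally have "real n / real L = real (n div L) + real (n mod L) / real L" .
        moreover have "0 \<le> real (n mod L) / real L" "real (n mod L) / real L < 1"
          using L_pos by (simp_all add: divide_less_eq)
        ultimately show "real n / real L - 2 \<le> real (n div L - 1)" "real (n div L - 1) \<le> real n / real L"
          by linarith+
      qed
      show "\<forall>\<^sub>F n in sequentially. c / real L - 2 * c / real n \<le> h n"
        using eventually_gt_at_top[of 0]
      proof eventually_elim
        case (elim n)
        have "(real n / real L - 2) * c / real n \<le> real (n div L - 1) * c / real n"
          using c div by (intro divide_right_mono mult_right_mono) auto
        thus ?case using elim by (simp add: h_def c_def[symmetric] field_simps)
      qed
      show "\<forall>\<^sub>F n in sequentially. h n \<le> c / real L"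
        using eventually_gt_at_top[of 0]
      proof eventually_elim
        case (elim n)
        have "real (n div L - 1) * c / real n \<le> (real n / real L) * c / real n"
          using c div by (intro divide_right_mono mult_right_mono) auto
        thus ?case using elim by (simp add: h_def c_def[symmetric])
      qed
    qed
    thus ?thesis by simp
  qed
  hence "ereal (ln (real N) / real L) = liminf (\<lambda>n. ereal (h n))"
    by (rule lim_imp_Liminf[OF trivial_limit_sequentially, symmetric])
  also have "\<dots> \<le> entropy_of_partition \<mu> T P"
    unfolding entropy_of_partition_def
  proof (rule Liminf_mono)
    show "\<forall>\<^sub>F n in sequentially. ereal (h n) \<le> ereal (partition_entropy \<mu> (refined_partition \<mu> T P n) / real n)"
      using eventually_ge_at_top[of L] by eventually_elim (use bound in simp)
  qed
  also have "\<dots> \<le> ks_entropy \<mu> T"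
    unfolding ks_entropy_def using P by (intro SUP_upper) simp
  finally show ?thesis .
qed

end

section \<open>Exponentially small pressure is impossible\<close>

context hoelder_shift
begin

lemma pressure_ge_of_loops:
  assumes N: "0 < N" and L: "0 < L" and b: "inj_on b {..<N}"
    and loops: "\<And>j. j < N \<Longrightarrow> length (b j) = L \<and> link v (b j) v"
    and s: "\<And>j y. j < N \<Longrightarrow> y \<in> X \<Longrightarrow> seg y 0 L = b j \<Longrightarrow> s \<le> birkhoff L y"
    and t: "0 \<le> t"
  shows "ereal ((ln (real N) + t * s) / real L) \<le> pressure I \<Lambda> X (\<lambda>x. t * \<phi> x)"
proof -
  interpret H: horseshoe I \<Lambda> M ok X b N L v
    using assms by unfold_locales auto
  interpret O: prob_space H.\<Omega> by (rule H.prob_space_\<Omega>)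
  obtain B where B: "\<forall>x\<in>X. \<bar>\<phi> x\<bar> \<le> B" using ex_bound by blast
  have int: "integrable H.\<Omega> (\<lambda>\<xi>. \<phi> (H.point j \<xi>))" for j
  proof (rule O.integrable_const_bound)
    show "AE \<xi> in H.\<Omega>. norm (\<phi> (H.point j \<xi>)) \<le> B"
      using B H.point_in_X by (intro AE_I2) simp
    show "(\<lambda>\<xi>. \<phi> (H.point j \<xi>)) \<in> borel_measurable H.\<Omega>"
      by (rule measurable_compose[OF H.measurable_point measurable_potential])
  qed
  have "s = (\<integral>\<xi>. s \<partial>H.\<Omega>)" using O.prob_space by simp
  also have "\<dots> \<le> (\<integral>\<xi>. (\<Sum>j<L. \<phi> (H.point j \<xi>)) \<partial>H.\<Omega>)"
  proof (rule integral_mono)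
    fix \<xi> assume \<xi>: "\<xi> \<in> space H.\<Omega>"
    have "seg (H.point 0 \<xi>) 0 L = seg (H.chain \<xi>) 0 L"
      by (simp add: seg_eq_iff H.point_def nonneg_in_index)
    hence "seg (H.point 0 \<xi>) 0 L = b (\<xi> 0)"
      using H.seg_chain_block[OF \<xi>, of 0] by simp
    hence "s \<le> birkhoff L (H.point 0 \<xi>)"
      by (rule s[OF H.coordinate_less[OF \<xi>] H.point_in_X[OF \<xi>]])
    thus "s \<le> (\<Sum>j<L. \<phi> (H.point j \<xi>))"
      by (simp add: birkhoff_def H.T_power_point)
  qed (use int in auto)
  also have "\<dots> = (\<Sum>j<L. \<integral>\<xi>. \<phi> (H.point j \<xi>) \<partial>H.\<Omega>)"
    using int by (intro Bochner_Integration.integral_sum)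
  finally have "s / real L \<le> (\<integral>x. \<phi> x \<partial>H.\<mu>)"
    using H.integral_\<mu>[OF measurable_potential, of B] B by (simp add: divide_right_mono)
  from mult_left_mono[OF this t] have "t * (s / real L) \<le> (\<integral>x. t * \<phi> x \<partial>H.\<mu>)"
    by simp
  hence "ereal (ln (real N) / real L) + ereal (t * (s / real L))
      \<le> ks_entropy H.\<mu> T + ereal (\<integral>x. t * \<phi> x \<partial>H.\<mu>)"
    by (intro add_mono H.entropy_\<mu>) simp
  also have "\<dots> \<le> pressure I \<Lambda> X (\<lambda>x. t * \<phi> x)"
    unfolding pressure_def by (rule SUP_upper[OF H.\<mu>_invariant])
  finally show ?thesis by (simp add: add_divide_distrib)
qed

text \<open>
  Choose \<open>r\<close> between \<open>exp (D * t + 1)\<close> and twice that, so that \<open>ln r\<close> exceeds the cost \<open>t * D\<close>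
  of a loop by \<open>1\<close> while the length of the loops is of order \<open>exp (D * t)\<close>.
\<close>

lemma exponential_lower_bound:
  assumes good: "\<forall>m. \<exists>x\<in>X. returning x m \<and> - 1 \<le> birkhoff m x"
  shows "\<exists>c>0. \<exists>D. \<forall>t\<ge>0. ereal (c * exp (- (D * t))) \<le> pressure I \<Lambda> X (\<lambda>x. t * \<phi> x)"
proof -
  obtain K :: nat and C' where K: "0 < K" and loops: "\<And>r. 1 \<le> r \<Longrightarrow> \<exists>L v b. 0 < L \<and> L \<le> K * r \<and>
      inj_on b {..<r} \<and> (\<forall>j<r. length (b j) = L \<and> link v (b j) v \<and>
              (\<forall>y\<in>X. seg y 0 L = b j \<longrightarrow> - C' \<le> birkhoff L y))"
    using many_loops[OF good] by blast
  define D where "D = \<bar>C'\<bar>"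
  define c where "c = 1 / (2 * real K * exp 1)"
  have "ereal (c * exp (- (D * t))) \<le> pressure I \<Lambda> X (\<lambda>x. t * \<phi> x)" if t: "0 \<le> t" for t
  proof -
    define e where "e = exp (D * t + 1)"
    define r where "r = nat \<lceil>e\<rceil>"
    have "1 \<le> e" using t by (simp add: e_def D_def)
    hence r: "1 \<le> r" "e \<le> real r" "real r \<le> 2 * e" unfolding r_def by linarith+
    obtain L v b where L: "0 < L" "L \<le> K * r" and b: "inj_on b {..<r}"
      and j: "\<And>j. j < r \<Longrightarrow> length (b j) = L \<and> link v (b j) v"
      and s: "\<And>j y. j < r \<Longrightarrow> y \<in> X \<Longrightarrow> seg y 0 L = b j \<Longrightarrow> - C' \<le> birkhoff L y"
      using loops[OF r(1)] by blast
    have "ln e \<le> ln (real r)" using r \<open>1 \<le> e\<close> by simp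
    hence "D * t + 1 \<le> ln (real r)" by (simp add: e_def)
    moreover have "C' * t \<le> D * t" using t by (intro mult_right_mono) (simp_all add: D_def)
    ultimately have one: "1 \<le> ln (real r) + t * - C'" by (simp add: mult.commute)
    have "real L \<le> real K * real r" using L by (simp flip: of_nat_mult)
    also have "\<dots> \<le> real K * (2 * e)" using r by (intro mult_left_mono) auto
    finally have "real L \<le> 2 * real K * e" by simp
    hence "1 / (2 * real K * e) \<le> 1 / real L"
      using L K \<open>1 \<le> e\<close> by (intro divide_left_mono mult_pos_pos) auto
    also have "\<dots> \<le> (ln (real r) + t * - C') / real L" using one by (intro divide_right_mono) auto
    finally have "ereal (1 / (2 * real K * e)) \<le> ereal ((ln (real r) + t * - C') / real L)" by simp
    also have "\<dots> \<le> pressure I \<Lambda> X (\<lambda>x. t * \<phi> x)"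
      using r by (intro pressure_ge_of_loops[OF _ L(1) b j s t]) auto
    also have "1 / (2 * real K * e) = c * exp (- (D * t))"
      by (simp add: c_def e_def exp_add exp_minus divide_simps)
    finally show ?thesis .
  qed
  moreover have "0 < c" using K by (simp add: c_def)
  ultimately show ?thesis by blast
qed

lemma pressure_neq_gauss:
  assumes \<alpha>: "0 < \<alpha>"
    and eq: "\<And>t. \<alpha> < t \<Longrightarrow> pressure I \<Lambda> X (\<lambda>x. t * \<phi> x) = ereal (gauss t)"
  shows False
proof (cases "\<forall>m. \<exists>x\<in>X. returning x m \<and> - 1 \<le> birkhoff m x")
  case True
  then obtain c D where c: "0 < c"
    and lower: "\<And>t. 0 \<le> t \<Longrightarrow> ereal (c * exp (- (D * t))) \<le> pressure I \<Lambda> X (\<lambda>x. t * \<phi> x)"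
    using exponential_lower_bound by blast
  have "c * exp (- (D * t)) \<le> gauss t" if "\<alpha> < t" for t
    using lower[of t] eq[OF that] that \<alpha> by simp
  hence "c \<le> 0" by (rule exponential_not_below_gauss)
  thus False using c by simp
next
  case False
  then obtain m where m: "\<And>x. x \<in> X \<Longrightarrow> returning x m \<Longrightarrow> birkhoff m x \<le> - 1"
    by (meson linorder_linear)
  have bound: "ks_entropy \<mu> T + ereal (t * (\<integral>x. \<phi> x \<partial>\<mu>)) \<le> ereal (gauss t)"
    if "\<mu> \<in> invariant_measures I \<Lambda> X" "\<alpha> < t" for \<mu> t
    using that SUP_upper[of \<mu> "invariant_measures I \<Lambda> X"
        "\<lambda>\<mu>. ks_entropy \<mu> T + ereal (\<integral>x. t * \<phi> x \<partial>\<mu>)"]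
    by (simp add: eq[OF that(2), symmetric] pressure_def)
  have int: "(\<integral>x. \<phi> x \<partial>\<mu>) \<le> 0" if \<mu>: "\<mu> \<in> invariant_measures I \<Lambda> X" for \<mu>
  proof (rule ccontr)
    assume "\<not> (\<integral>x. \<phi> x \<partial>\<mu>) \<le> 0"
    hence pos: "0 < (\<integral>x. \<phi> x \<partial>\<mu>)" by simp
    \<comment> \<open>At this parameter the integral alone exceeds the bound \<open>gauss t \<le> 1\<close>.\<close>
    define t where "t = \<alpha> + 2 / (\<integral>x. \<phi> x \<partial>\<mu>)"
    have t: "\<alpha> < t" using pos by (simp add: t_def)
    have "0 + ereal (t * (\<integral>x. \<phi> x \<partial>\<mu>)) \<le> ereal (gauss t)"
      using bound[OF \<mu> t] add_right_mono[OF ks_entropy_nonneg[OF invariant_measuresD(1)[OF \<mu>]]]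
      by (rule order_trans[rotated])
    hence "t * (\<integral>x. \<phi> x \<partial>\<mu>) \<le> 1" using gauss_le_1[of t] by simp
    moreover have "t * (\<integral>x. \<phi> x \<partial>\<mu>) = \<alpha> * (\<integral>x. \<phi> x \<partial>\<mu>) + 2"
      using pos by (simp add: t_def distrib_right)
    ultimately show False using mult_pos_pos[OF \<alpha> pos] by simp
  qed
  define t0 where "t0 = \<alpha> + 1"
  define t where "t = t0 + real m * gauss t0"
  have "0 \<le> real m * gauss t0" using gauss_pos[of t0] by simp
  hence "\<alpha> < t" by (simp add: t_def t0_def)
  have "pressure I \<Lambda> X (\<lambda>x. t * \<phi> x) \<le> 0"
    using \<alpha> gauss_pos[of t0]
    by (intro pressure_nonpos_of_negative_returns[where s = t0 and E = "gauss t0", OF m int bound])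
      (auto simp: t_def t0_def)
  thus False using eq[OF \<open>\<alpha> < t\<close>] gauss_pos[of t] by simp
qed

end

theorem theorem1p7:
  fixes \<alpha> :: real
  assumes "\<alpha> > 0"
  shows "\<exists>F :: real \<Rightarrow> real.
           strictly_convex_on {\<alpha><..} F \<and>
           real_analytic_on {\<alpha><..} F \<and>
           (\<exists>\<gamma>\<^sub>1 \<gamma>\<^sub>2. 0 \<le> \<gamma>\<^sub>1 \<and> \<gamma>\<^sub>1 \<le> \<gamma>\<^sub>2 \<and>
              (\<forall>t\<^sub>0 m. supporting_line {\<alpha><..} F t\<^sub>0 m \<longrightarrow> F t\<^sub>0 - m * t\<^sub>0 \<in> {\<gamma>\<^sub>1..\<gamma>\<^sub>2})) \<and>
           \<not> (\<exists>I \<Lambda> X \<phi>. (I = {0..} \<or> I = UNIV) \<and>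
                 shift_of_finite_type I \<Lambda> X \<and> hoelder_potential I X \<phi> \<and>
                 (\<forall>t>\<alpha>. pressure I \<Lambda> X (\<lambda>x. t * \<phi> x) = ereal (F t)))"
proof (intro exI[of _ gauss] conjI)
  show "strictly_convex_on {\<alpha><..} gauss" "real_analytic_on {\<alpha><..} gauss"
    using assms by (intro strictly_convex_gauss real_analytic_gauss; simp)+
  show "\<exists>\<gamma>\<^sub>1 \<gamma>\<^sub>2. 0 \<le> \<gamma>\<^sub>1 \<and> \<gamma>\<^sub>1 \<le> \<gamma>\<^sub>2 \<and>
      (\<forall>t\<^sub>0 m. supporting_line {\<alpha><..} gauss t\<^sub>0 m \<longrightarrow> gauss t\<^sub>0 - m * t\<^sub>0 \<in> {\<gamma>\<^sub>1..\<gamma>\<^sub>2})"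
    using gauss_intercept[of \<alpha>] assms by (intro exI[of _ 0] exI[of _ 3]) simp
  show "\<not> (\<exists>I \<Lambda> X \<phi>. (I = {0..} \<or> I = UNIV) \<and>
                 shift_of_finite_type I \<Lambda> X \<and> hoelder_potential I X \<phi> \<and>
                 (\<forall>t>\<alpha>. pressure I \<Lambda> X (\<lambda>x. t * \<phi> x) = ereal (gauss t)))"
  proof (intro notI, elim exE conjE)
    fix I \<Lambda> X \<phi>
    assume I: "I = {0..} \<or> I = UNIV" and X: "shift_of_finite_type I \<Lambda> X"
      and \<phi>: "hoelder_potential I X \<phi>"
      and eq: "\<forall>t>\<alpha>. pressure I \<Lambda> X (\<lambda>x. t * \<phi> x) = ereal (gauss t)"
    obtain M ok where "window_shift I \<Lambda> M ok X"
      using shift_of_finite_type_windows[OF I X] by blast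
    then interpret window_shift I \<Lambda> M ok X .
    have "X \<subseteq> I \<rightarrow>\<^sub>E \<Lambda>" by (auto simp: X_eq)
    then obtain C \<theta> where "0 \<le> C" "0 < \<theta>" "\<theta> < 1" "\<forall>x\<in>X. \<forall>y\<in>X. \<forall>k.
        (\<forall>i\<in>I. \<bar>i\<bar> < int k \<longrightarrow> x i = y i) \<longrightarrow> \<bar>\<phi> x - \<phi> y\<bar> \<le> C * \<theta> ^ k"
      using hoelder_potential_geometric[OF _ \<phi>] by blast
    then interpret hoelder_shift I \<Lambda> M ok X \<phi> C \<theta>
      by unfold_locales auto
    show False using pressure_neq_gauss[OF assms] eq by blast
  qed
qed

end
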